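(* Let $W$ be a real Hilbert space, let $V:W\to\mathbb{R}$ be a quadratic potential with unique minimizer $w^\star$ and sample gradients $\nabla V_z(w)=A(z)w+B(z)$, $z\in Z$, as described in the context. Assume: (1) there is $\sigma\ge 0$ such that $\|\nabla V_z(w^\star)\|^2\le\sigma^2$ for all $z\in Z$; (2) for all $z\in Z$ the function $V_z$ is $\eta$-smooth and $\kappa$-strongly convex, i.e. $\kappa I\le \nabla^2V_z(w)\le \eta I$ for all $w\in W$, with $0<\kappa\le\eta$; set $\alpha=\kappa/\eta$, and assume $\alpha\in(0,\tfrac12)$. Let $(z_t)_{t\in\mathbb{N}}$ be a time-homogeneous Markov chain on the measurable space $(Z,\mathcal{B}(Z))$, started from an arbitrary initial distribution, with transition kernel $P$, unique stationary probability measure $\rho$, and mixing time $t_{\mathrm{mix}}$. Let $\gamma_t=\frac{1}{\eta t}$, let $w_1\in W$, and define $w_{t+1}=w_t-\gamma_t\nabla V_{z_t}(w_t)$ for $t\in\mathbb{N}$. Then for each $t\in\mathbb{N}$, $$\|w_t-w^\star\|\le \mathcal{E}_{\mathrm{init}}(t)+\mathcal{E}_{\mathrm{samp}}(t),$$ where $$\mathcal{E}_{\mathrm{init}}(t)\le \left(\frac1t\right)^{\alpha}\|w_1-w^\star\|,$$ and, for every $\delta\in(0,1)$, with probability at least $1-\delta$ in the space $Z^{t-1}$ (i.e. with respect to the law of $(z_1,\dots,z_{t-1})$), $$\mathcal{E}_{\mathrm{samp}}(t)\le \frac{2\sigma}{\eta}\sqrt{\frac{7}{\delta(1-2\alpha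)}}\;\sqrt{\frac{t_{\mathrm{mix}}}{t^{\alpha}}}.$$
   Context: Quadratic potential: $V(w)=\frac12\langle Aw,w\rangle+\langle B,w\rangle+C$, where $A:W\to W$ is a positive definite bounded linear operator with bounded inverse, $B\in W$, $C\in\mathbb{R}$; so $\nabla V(w)=Aw+B$ and the unique minimizer is $w^\star=-A^{-1}B$. For each sample $z\in Z$ there is a quadratic function $V_z$ on $W$ with $\nabla V_z(w)=A(z)w+B(z)$, where $A(\cdot):Z\to SL(W)$ takes values in the symmetric bounded linear operators on $W$ and $B(\cdot):Z\to W$ (so $\nabla^2V_z(w)=A(z)$). It is assumed that $\nabla V_z(w)$ is Bochner integrable in $z$ with respect to $\rho$, and that $\mathbb{E}_{z\sim\rho}[\nabla V_z(w^\star)]=0$. Mixing time: $d(t)=\sup_{z\in Z}\|P^t(z,\cdot)-\rho\|_{\mathrm{TV}}$, where $P^t$ is the $t$-step transition kernel and $\|\mu-\nu\|_{\mathrm{TV}}=\sup_{A\in\mathcal{B}(Z)}|\mu(A)-\nu(A)|$; $t_{\mathrm{mix}}(\epsilon)=\min\{t\ge1: d(t)\le\epsilon\}$ and $t_{\mathrm{mix}}=t_{\mathrm{mix}}(1/4)$, implicitly assumed to exist (finite). Errors: write $A_k=A(z_k)$, $Y_i=\nabla V_{z_i}(w^\star)$, and $X_{i+1}^{s}=\prod_{k=i+1}^{s}(I-\gamma_kA_k)$ (factors with larger $k$ applied later, i.e. standing to the left), with $X_{i+1}^s=I$ if $i\ge s$. Then $$\mathcal{E}_{\mathrm{init}}(t)=\|X_1^{t-1}(w_1-w^\star)\|,\qquad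 \mathcal{E}_{\mathrm{samp}}(t)=\Big\|\sum_{i=1}^{t-1}\gamma_iX_{i+1}^{t-1}Y_i\Big\|.$$ *)

theory Defs
  imports "HOL-Probability.Probability"
begin

subsection \<open>Bochner integration in an arbitrary Banach space\<close>

text \<open>
  The Bochner integral of the library is restricted to second countable spaces, where strong
  measurability coincides with Borel measurability. To cover non-separable Hilbert spaces we
  repeat the library definition with strong measurability (everywhere, since the chain below may
  charge null sets of its stationary measure) in place of Borel measurability; the two notions
  agree on second countable spaces, see \<open>has_bochner_int_iff\<close>.
\<close>

definition strongly_measurable :: "'a measure \<Rightarrow> ('a \<Rightarrow> 'b::topological_space) \<Rightarrow> bool" where
  "strongly_measurable M f \<longleftrightarrow>
     (\<exists>s. (\<forall>i::nat. simple_function M (s i)) \<and> (\<forall>x\<in>space M. (\<lambda>i. s i x) \<longlonglongrightarrow> f x))"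

definition has_bochner_int :: "'a measure \<Rightarrow> ('a \<Rightarrow> 'b::real_normed_vector) \<Rightarrow> 'b \<Rightarrow> bool" where
  "has_bochner_int M f x \<longleftrightarrow>
     strongly_measurable M f \<and>
     (\<exists>s. (\<forall>i::nat. Bochner_Integration.simple_bochner_integrable M (s i)) \<and>
          (\<lambda>i. \<integral>\<^sup>+y. ennreal (norm (f y - s i y)) \<partial>M) \<longlonglongrightarrow> 0 \<and>
          (\<lambda>i. Bochner_Integration.simple_bochner_integral M (s i)) \<longlonglongrightarrow> x)"

definition bochner_integrable :: "'a measure \<Rightarrow> ('a \<Rightarrow> 'b::real_normed_vector) \<Rightarrow> bool" where
  "bochner_integrable M f \<longleftrightarrow> (\<exists>x. has_bochner_int M f x)"

lemma strongly_measurable_iff: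
  fixes f :: "'a \<Rightarrow> 'b::{real_normed_vector, second_countable_topology}"
  shows "strongly_measurable M f \<longleftrightarrow> f \<in> borel_measurable M"
proof
  assume "strongly_measurable M f"
  then obtain s where s: "\<And>i::nat. simple_function M (s i)"
    "\<And>x. x \<in> space M \<Longrightarrow> (\<lambda>i. s i x) \<longlonglongrightarrow> f x"
    unfolding strongly_measurable_def by blast
  show "f \<in> borel_measurable M"
    by (rule borel_measurable_LIMSEQ_metric[of s])
      (auto intro: s borel_measurable_simple_function)
next
  assume "f \<in> borel_measurable M"
  from borel_measurable_implies_sequence_metric[OF this, of 0]
  show "strongly_measurable M f"
    unfolding strongly_measurable_def by blast
qed

lemma has_bochner_int_iff:
  fixes f :: "'a \<Rightarrow> 'b::{real_normed_vector, second_countable_topology}"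
  shows "has_bochner_int M f x \<longleftrightarrow> has_bochner_integral M f x"
  unfolding has_bochner_int_def strongly_measurable_iff has_bochner_integral.simps by blast


subsection \<open>Gradients and quadratic potentials\<close>

definition grad :: "('w::real_inner \<Rightarrow> real) \<Rightarrow> 'w \<Rightarrow> 'w" where
  "grad f w = (THE g. GDERIV f w :> g)"

lemma grad_eq:
  assumes "GDERIV f w :> g"
  shows "grad f w = g"
  unfolding grad_def
proof (rule the_equality)
  show "GDERIV f w :> g" by (rule assms)
next
  fix g' assume "GDERIV f w :> g'"
  with assms have "(\<lambda>h. inner h g') = (\<lambda>h. inner h g)"
    unfolding gderiv_def using has_derivative_unique by blast
  then have "inner (g' - g) (g' - g) = 0"
    by (metis (no_types) diff_self inner_diff_right)
  then show "g' = g" by simp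
qed

definition quadratic :: "('w::real_inner \<Rightarrow>\<^sub>L 'w) \<Rightarrow> 'w \<Rightarrow> real \<Rightarrow> 'w \<Rightarrow> real" where
  "quadratic A B C w = (1/2) * (blinfun_apply A w \<bullet> w) + B \<bullet> w + C"

definition symmetric_op :: "('w::real_inner \<Rightarrow>\<^sub>L 'w) \<Rightarrow> bool" where
  "symmetric_op A \<longleftrightarrow> (\<forall>u v. blinfun_apply A u \<bullet> v = u \<bullet> blinfun_apply A v)"

definition pos_def_op :: "('w::real_inner \<Rightarrow>\<^sub>L 'w) \<Rightarrow> bool" where
  "pos_def_op A \<longleftrightarrow> symmetric_op A \<and> (\<forall>v. v \<noteq> 0 \<longrightarrow> 0 < blinfun_apply A v \<bullet> v)"

definition bounded_inverse_op :: "('w::real_normed_vector \<Rightarrow>\<^sub>L 'w) \<Rightarrow> bool" where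
  "bounded_inverse_op A \<longleftrightarrow>
     (\<exists>R. A o\<^sub>L R = id_blinfun \<and> R o\<^sub>L A = id_blinfun)"

definition loewner_le :: "('w::real_inner \<Rightarrow> 'w) \<Rightarrow> ('w \<Rightarrow> 'w) \<Rightarrow> bool" where
  "loewner_le S T \<longleftrightarrow> (\<forall>v. S v \<bullet> v \<le> T v \<bullet> v)"

text \<open>\<open>\<kappa> I \<le> \<nabla>\<^sup>2 f(w) \<le> \<eta> I\<close> for all \<open>w\<close>, the Hessian being the Frechet derivative of the gradient.\<close>

definition smooth_strongly_convex :: "real \<Rightarrow> real \<Rightarrow> ('w::real_inner \<Rightarrow> real) \<Rightarrow> bool" where
  "smooth_strongly_convex \<kappa> \<eta> f \<longleftrightarrow>
     (\<forall>w. GDERIV f w :> grad f w) \<and>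
     (\<forall>w. \<exists>H. (grad f has_derivative H) (at w) \<and>
            loewner_le (\<lambda>v. \<kappa> *\<^sub>R v) H \<and> loewner_le H (\<lambda>v. \<eta> *\<^sub>R v))"


subsection \<open>Markov chains and mixing time\<close>

definition markov_kernel :: "'z measure \<Rightarrow> ('z \<Rightarrow> 'z measure) \<Rightarrow> bool" where
  "markov_kernel Z P \<longleftrightarrow> P \<in> Z \<rightarrow>\<^sub>M prob_algebra Z"

primrec kernel_pow :: "'z measure \<Rightarrow> ('z \<Rightarrow> 'z measure) \<Rightarrow> nat \<Rightarrow> 'z \<Rightarrow> 'z measure" where
  "kernel_pow Z P 0 z = return Z z"
| "kernel_pow Z P (Suc t) z = bind (kernel_pow Z P t z) P"

definition stationary :: "'z measure \<Rightarrow> ('z \<Rightarrow> 'z measure) \<Rightarrow> 'z measure \<Rightarrow> bool" where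
  "stationary Z P \<rho> \<longleftrightarrow> prob_space \<rho> \<and> sets \<rho> = sets Z \<and> bind \<rho> P = \<rho>"

text \<open>The sigma-algebra generated by \<open>z\<^sub>1, \<dots>, z\<^sub>t\<close>.\<close>

definition history :: "'m measure \<Rightarrow> 'z measure \<Rightarrow> (nat \<Rightarrow> 'm \<Rightarrow> 'z) \<Rightarrow> nat \<Rightarrow> 'm measure" where
  "history M Z z t =
     vimage_algebra (space M) (\<lambda>\<omega>. \<lambda>i\<in>{1..t}. z i \<omega>) (Pi\<^sub>M {1..t} (\<lambda>_. Z))"

text \<open>Chains are indexed by the positive integers; \<open>z 0\<close> is ignored. The law of \<open>z 1\<close> is arbitrary.\<close>

definition markov_chain ::
  "'m measure \<Rightarrow> 'z measure \<Rightarrow> ('z \<Rightarrow> 'z measure) \<Rightarrow> (nat \<Rightarrow> 'm \<Rightarrow> 'z) \<Rightarrow> bool" where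
  "markov_chain M Z P z \<longleftrightarrow>
     prob_space M \<and> markov_kernel Z P \<and> (\<forall>t\<ge>1. z t \<in> M \<rightarrow>\<^sub>M Z) \<and>
     (\<forall>t\<ge>1. \<forall>B\<in>sets Z. AE \<omega> in M.
        real_cond_exp M (history M Z z t) (indicator {\<omega>\<in>space M. z (Suc t) \<omega> \<in> B}) \<omega>
          = measure (P (z t \<omega>)) B)"

text \<open>The law of \<open>(z\<^sub>1, \<dots>, z\<^sub>n)\<close> on \<open>Z\<^sup>n\<close>.\<close>

definition path_law :: "'m measure \<Rightarrow> 'z measure \<Rightarrow> (nat \<Rightarrow> 'm \<Rightarrow> 'z) \<Rightarrow> nat \<Rightarrow> (nat \<Rightarrow> 'z) measure" where
  "path_law M Z z n = distr M (Pi\<^sub>M {1..n} (\<lambda>_. Z)) (\<lambda>\<omega>. \<lambda>i\<in>{1..n}. z i \<omega>)"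

definition tv_dist :: "'z measure \<Rightarrow> 'z measure \<Rightarrow> real" where
  "tv_dist \<mu> \<nu> = (SUP B\<in>sets \<mu>. \<bar>measure \<mu> B - measure \<nu> B\<bar>)"

definition mix_dist :: "'z measure \<Rightarrow> ('z \<Rightarrow> 'z measure) \<Rightarrow> 'z measure \<Rightarrow> nat \<Rightarrow> real" where
  "mix_dist Z P \<rho> t = (SUP x\<in>space Z. tv_dist (kernel_pow Z P t x) \<rho>)"

text \<open>Meaningful only if some \<open>t \<ge> 1\<close> satisfies \<open>mix_dist Z P \<rho> t \<le> \<epsilon>\<close>.\<close>

definition mixing_time :: "'z measure \<Rightarrow> ('z \<Rightarrow> 'z measure) \<Rightarrow> 'z measure \<Rightarrow> real \<Rightarrow> nat" where
  "mixing_time Z P \<rho> \<epsilon> = (LEAST t. 1 \<le> t \<and> mix_dist Z P \<rho> t \<le> \<epsilon>)"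


subsection \<open>Initial and sampling error\<close>

text \<open>\<open>X_prod \<gamma> A m s\<close> is \<open>(I - \<gamma>\<^sub>s A\<^sub>s) \<cdots> (I - \<gamma>\<^sub>m A\<^sub>m)\<close>, and the identity if \<open>m > s\<close>.\<close>

definition X_prod ::
  "(nat \<Rightarrow> real) \<Rightarrow> (nat \<Rightarrow> 'w::real_normed_vector \<Rightarrow>\<^sub>L 'w) \<Rightarrow> nat \<Rightarrow> nat \<Rightarrow> 'w \<Rightarrow>\<^sub>L 'w" where
  "X_prod \<gamma> A m s = fold (\<lambda>k X. (id_blinfun - \<gamma> k *\<^sub>R A k) o\<^sub>L X) [m..<Suc s] id_blinfun"

definition err_init ::
  "(nat \<Rightarrow> real) \<Rightarrow> (nat \<Rightarrow> 'w::real_normed_vector \<Rightarrow>\<^sub>L 'w) \<Rightarrow> 'w \<Rightarrow> 'w \<Rightarrow> nat \<Rightarrow> real" where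
  "err_init \<gamma> A w1 wstar t = norm (blinfun_apply (X_prod \<gamma> A 1 (t - 1)) (w1 - wstar))"

definition err_samp ::
  "(nat \<Rightarrow> real) \<Rightarrow> (nat \<Rightarrow> 'w::real_normed_vector \<Rightarrow>\<^sub>L 'w) \<Rightarrow> (nat \<Rightarrow> 'w) \<Rightarrow> nat \<Rightarrow> real" where
  "err_samp \<gamma> A Y t =
     norm (\<Sum>i=1..t - 1. \<gamma> i *\<^sub>R blinfun_apply (X_prod \<gamma> A (i + 1) (t - 1)) (Y i))"

end

theory Submission
  imports Defs
begin

text \<open>
  The sampling error satisfies \<open>e\<^sub>1 = 0\<close> and
  \<open>e\<^sub>t\<^sub>+\<^sub>1 = (I - \<gamma>\<^sub>t A\<^sub>t) e\<^sub>t + \<gamma>\<^sub>t Y\<^sub>t\<close>, where \<open>I - \<gamma>\<^sub>t A\<^sub>t\<close> contracts by \<open>1 - \<alpha>/t\<close>.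
  Pathwise, \<open>\<parallel>e\<^sub>t\<parallel> \<le> (\<sigma>/\<eta>) H\<^sub>t\<^sub>-\<^sub>1\<close> with the harmonic numbers \<open>H\<close>, hence
  \<open>\<parallel>e\<^sub>j\<^sub>+\<^sub>1 - e\<^sub>j\<parallel> \<le> (\<sigma>/\<eta>) (1 + H\<^sub>j\<^sub>-\<^sub>1)/j\<close>. In the recursion for \<open>E \<parallel>e\<^sub>t\<parallel>\<^sup>2\<close> the cross term
  \<open>E \<langle>e\<^sub>t, Y\<^sub>t\<rangle>\<close> telescopes into \<open>\<Sum>j<t. E \<langle>e\<^sub>j\<^sub>+\<^sub>1 - e\<^sub>j, Y\<^sub>t\<rangle>\<close>. As \<open>e\<^sub>j\<^sub>+\<^sub>1 - e\<^sub>j\<close> depends only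
  on \<open>z\<^sub>1, \<dots>, z\<^sub>j\<close> and \<open>Y\<close> has mean zero under \<open>\<rho>\<close>, mixing damps the \<open>j\<close>-th summand by
  \<open>(1/2) ^ ((t - j) div t\<^sub>m\<^sub>i\<^sub>x)\<close>. Multiplying by the weights \<open>t\<^sup>\<alpha>\<close> and summing, the
  mixing factors contribute \<open>2 t\<^sub>m\<^sub>i\<^sub>x\<close>, and with \<open>1 + H\<^sub>j\<^sub>-\<^sub>1 \<le> (8/5) \<surd>j\<close> the rest is bounded by
  \<open>\<Sum>j. j powr (\<alpha> - 3/2)\<close>, which is at most \<open>3/(1 - 2\<alpha>)\<close>. This gives
  \<open>E \<parallel>e\<^sub>t\<parallel>\<^sup>2 \<le> (\<sigma>/\<eta>)\<^sup>2 28 t\<^sub>m\<^sub>i\<^sub>x / ((1 - 2\<alpha>) t\<^sup>\<alpha>)\<close>, and Markov's inequality concludes.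
\<close>

subsection \<open>Symmetric operators and products of gradient steps\<close>

text \<open>In operator form, \<open>(c - T) T (c - T) + T (c - T) T = c T (c - T)\<close>. Both
  summands on the left are nonnegative, hence \<open>T^2 \<le> c T \<le> c^2\<close>, without any
  functional calculus.\<close>

lemma norm_le_of_symmetric_sandwich:
  fixes T :: "'w::real_inner \<Rightarrow> 'w"
  assumes lin: "linear T" and sym: "\<And>u v. T u \<bullet> v = u \<bullet> T v"
    and nonneg: "\<And>v. 0 \<le> T v \<bullet> v" and upper: "\<And>v. T v \<bullet> v \<le> c * (v \<bullet> v)" and "0 < c"
  shows "norm (T v) \<le> c * norm v"
proof -
  \<comment> \<open>Nonnegativity is tested at \<open>u\<close>, the upper bound at
    \<open>T v\<close>.\<close>
  define u where "u = c *\<^sub>R v - T v"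
  have Tu: "T u = c *\<^sub>R T v - T (T v)"
    by (simp add: u_def linear_diff[OF lin] linear_scale[OF lin])
  have "T u \<bullet> u + (c * (T v \<bullet> T v) - T (T v) \<bullet> T v) = c * (c * (T v \<bullet> v) - T v \<bullet> T v)"
    unfolding Tu by (simp add: u_def inner_diff_left inner_diff_right sym[of "T v" v] algebra_simps)
  moreover have "0 \<le> T u \<bullet> u + (c * (T v \<bullet> T v) - T (T v) \<bullet> T v)"
    using nonneg[of u] upper[of "T v"] by simp
  ultimately have "0 \<le> c * (T v \<bullet> v) - T v \<bullet> T v"
    using \<open>0 < c\<close> by (simp add: zero_le_mult_iff)
  then have "(norm (T v))\<^sup>2 \<le> c * (T v \<bullet> v)"
    by (simp add: power2_norm_eq_inner)
  also have "\<dots> \<le> c * (c * (v \<bullet> v))"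
    using upper[of v] \<open>0 < c\<close> by simp
  also have "\<dots> = (c * norm v)\<^sup>2"
    unfolding power_mult_distrib power2_norm_eq_inner by (simp add: power2_eq_square)
  finally show ?thesis
    by (rule power2_le_imp_le) (use \<open>0 < c\<close> in simp)
qed

lemma norm_symmetric_op_le:
  fixes T :: "'w::real_inner \<Rightarrow>\<^sub>L 'w"
  assumes sym: "symmetric_op T" and lower: "\<And>v. \<kappa> * (v \<bullet> v) \<le> T v \<bullet> v"
    and upper: "\<And>v. T v \<bullet> v \<le> \<eta> * (v \<bullet> v)" and "0 < \<kappa>" "0 < \<eta>"
  shows "norm (T v) \<le> \<eta> * norm v"
proof (rule norm_le_of_symmetric_sandwich)
  show "0 \<le> T v \<bullet> v" for v
    using lower[of v] \<open>0 < \<kappa>\<close> by (meson inner_ge_zero less_imp_le mult_nonneg_nonneg order_trans)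
qed (use assms in \<open>auto simp: symmetric_op_def bounded_linear.linear blinfun.bounded_linear_right\<close>)

text \<open>\<open>I - \<gamma> T\<close> lies between \<open>0\<close> and
  \<open>(1 - \<gamma> \<kappa>) I\<close>: the lower bound needs
  \<open>\<gamma> * \<eta> \<le> 1\<close>, and \<open>\<gamma> * \<kappa> < 1\<close> makes the
  upper constant positive.\<close>

lemma norm_gradient_step_le:
  fixes T :: "'w::real_inner \<Rightarrow>\<^sub>L 'w"
  assumes sym: "symmetric_op T" and lower: "\<And>v. \<kappa> * (v \<bullet> v) \<le> T v \<bullet> v"
    and upper: "\<And>v. T v \<bullet> v \<le> \<eta> * (v \<bullet> v)"
    and "0 \<le> \<gamma>" "\<gamma> * \<eta> \<le> 1" "\<gamma> * \<kappa> < 1"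
  shows "norm (v - \<gamma> *\<^sub>R T v) \<le> (1 - \<gamma> * \<kappa>) * norm v"
proof (rule norm_le_of_symmetric_sandwich)
  show "linear (\<lambda>v. v - \<gamma> *\<^sub>R T v)"
    by (intro linearI) (simp_all add: blinfun.add_right blinfun.scaleR_right algebra_simps)
  show "(u - \<gamma> *\<^sub>R T u) \<bullet> v = u \<bullet> (v - \<gamma> *\<^sub>R T v)" for u v
    using sym by (simp add: symmetric_op_def inner_diff_left inner_diff_right)
  show "0 \<le> (v - \<gamma> *\<^sub>R T v) \<bullet> v" for v
  proof -
    have "\<gamma> * (T v \<bullet> v) \<le> \<gamma> * (\<eta> * (v \<bullet> v))"
      using upper[of v] \<open>0 \<le> \<gamma>\<close> by (rule mult_left_mono)
    also have "\<dots> \<le> 1 * (v \<bullet> v)"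
      unfolding mult.assoc[symmetric] using \<open>\<gamma> * \<eta> \<le> 1\<close> by (intro mult_right_mono) auto
    finally show ?thesis by (simp add: inner_diff_left)
  qed
  show "(v - \<gamma> *\<^sub>R T v) \<bullet> v \<le> (1 - \<gamma> * \<kappa>) * (v \<bullet> v)" for v
    using mult_left_mono[OF lower[of v] \<open>0 \<le> \<gamma>\<close>] by (simp add: inner_diff_left algebra_simps)
qed (use assms in auto)

text \<open>The derivative of an affine gradient is its linear part at every point, so by uniqueness
  the Hessian at \<open>0\<close> is \<open>T\<close> and the Loewner bounds pass to it.\<close>

lemma smooth_strongly_convex_affine_gradient:
  fixes T :: "'w::real_inner \<Rightarrow>\<^sub>L 'w"
  assumes conv: "smooth_strongly_convex \<kappa> \<eta> f" and grad: "\<And>v. GDERIV f v :> T v + b"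
  shows "\<kappa> * (v \<bullet> v) \<le> T v \<bullet> v" "T v \<bullet> v \<le> \<eta> * (v \<bullet> v)"
proof -
  have eq: "grad f = (\<lambda>v. T v + b)"
    using grad_eq[OF grad] by auto
  obtain H where H: "((\<lambda>v. T v + b) has_derivative H) (at 0)"
    "loewner_le (\<lambda>v. \<kappa> *\<^sub>R v) H" "loewner_le H (\<lambda>v. \<eta> *\<^sub>R v)"
    using conv unfolding smooth_strongly_convex_def eq by blast
  have "((\<lambda>v. T v + b) has_derivative T) (at 0)"
    by (auto intro!: derivative_eq_intros)
  then have "H = T"
    using H(1) has_derivative_unique by blast
  with H show "\<kappa> * (v \<bullet> v) \<le> T v \<bullet> v" "T v \<bullet> v \<le> \<eta> * (v \<bullet> v)"
    by (auto simp: loewner_le_def)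
qed

section \<open>Operator products and the recursion of the sampling error\<close>

lemma X_prod_empty: "s < m \<Longrightarrow> X_prod \<gamma> A m s = id_blinfun"
  by (simp add: X_prod_def)

lemma X_prod_Suc:
  "m \<le> Suc s \<Longrightarrow>
     X_prod \<gamma> A m (Suc s) v = X_prod \<gamma> A m s v - \<gamma> (Suc s) *\<^sub>R A (Suc s) (X_prod \<gamma> A m s v)"
  by (simp add: X_prod_def blinfun.diff_left blinfun.scaleR_left)

text \<open>The vector whose norm is \<open>err_samp\<close>, indexed by the number of samples used
  instead of by the iterate: time \<open>t\<close> corresponds to \<open>n = t - 1\<close>.\<close>

definition samp_sum ::
  "(nat \<Rightarrow> real) \<Rightarrow> (nat \<Rightarrow> 'w::real_normed_vector \<Rightarrow>\<^sub>L 'w) \<Rightarrow> (nat \<Rightarrow> 'w) \<Rightarrow> nat \<Rightarrow> 'w" where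
  "samp_sum \<gamma> A Y n = (\<Sum>i=1..n. \<gamma> i *\<^sub>R X_prod \<gamma> A (i + 1) n (Y i))"

lemma err_samp_eq_norm_samp_sum: "err_samp \<gamma> A Y t = norm (samp_sum \<gamma> A Y (t - 1))"
  by (simp add: err_samp_def samp_sum_def)

lemma samp_sum_0 [simp]: "samp_sum \<gamma> A Y 0 = 0"
  by (simp add: samp_sum_def)

text \<open>All old products receive the same new left factor, which acts on the whole sum by
  linearity; the new summand carries an empty product.\<close>

lemma samp_sum_Suc:
  "samp_sum \<gamma> A Y (Suc n) =
     samp_sum \<gamma> A Y n - \<gamma> (Suc n) *\<^sub>R A (Suc n) (samp_sum \<gamma> A Y n) + \<gamma> (Suc n) *\<^sub>R Y (Suc n)"
proof -
  have "(\<Sum>i=1..n. \<gamma> i *\<^sub>R X_prod \<gamma> A (i + 1) (Suc n) (Y i))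
      = samp_sum \<gamma> A Y n - \<gamma> (Suc n) *\<^sub>R A (Suc n) (samp_sum \<gamma> A Y n)"
    by (simp add: samp_sum_def X_prod_Suc blinfun.sum_right blinfun.scaleR_right scaleR_diff_right
        sum_subtractf scaleR_sum_right mult.commute)
  then show ?thesis
    by (simp add: samp_sum_def X_prod_empty)
qed

lemma samp_sum_cong:
  "(\<And>i. 1 \<le> i \<Longrightarrow> i \<le> n \<Longrightarrow> A i = A' i) \<Longrightarrow> (\<And>i. 1 \<le> i \<Longrightarrow> i \<le> n \<Longrightarrow> Y i = Y' i) \<Longrightarrow>
     samp_sum \<gamma> A Y n = samp_sum \<gamma> A' Y' n"
  by (induction n) (simp_all add: samp_sum_Suc)

subsection \<open>Numerical estimates\<close>

text \<open>The left factor is at most \<open>exp (- a / t)\<close> and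
  \<open>(1 + 1/t) powr a\<close> is at most \<open>exp (a / t)\<close>; the exponentials cancel.
  Thus one contraction step pays for the growth of the weight \<open>t powr a\<close>.\<close>

lemma one_minus_mult_powr_Suc_le:
  fixes a :: real
  assumes "1 \<le> t" "0 \<le> a"
  shows "(1 - a / real t) * real (Suc t) powr a \<le> real t powr a"
proof -
  have t: "real t > 0" using assms by simp
  have "real (Suc t) = real t * (1 + 1 / real t)"
    using t by (simp add: field_simps)
  then have "real (Suc t) powr a = real t powr a * (1 + 1 / real t) powr a"
    using t by (simp add: powr_mult)
  also have "(1 + 1 / real t) powr a \<le> exp (a / real t)"
    using t assms mult_left_mono[OF ln_add_one_self_le_self[of "1 / real t"], of a]
    by (simp add: powr_def mult.commute add_eq_0_iff)
  finally have *: "real (Suc t) powr a \<le> real t powr a * exp (a / real t)"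
    using t by (simp add: mult_left_mono)
  have "1 - a / real t \<le> exp (- (a / real t))"
    using exp_ge_add_one_self[of "- (a / real t)"] by simp
  then have "(1 - a / real t) * real (Suc t) powr a \<le> exp (- (a / real t)) * real (Suc t) powr a"
    by (intro mult_right_mono) auto
  also have "\<dots> \<le> exp (- (a / real t)) * (real t powr a * exp (a / real t))"
    using * by (intro mult_left_mono) auto
  also have "\<dots> = real t powr a"
    by (simp add: exp_minus field_simps)
  finally show ?thesis .
qed

text \<open>The induction step reduces to \<open>sqrt (x + 1) + sqrt x \<le> 8/5 * x\<close>, which
  fails at \<open>x = 1\<close> and holds from \<open>x = 2\<close> on; hence the separate case
  \<open>n = 0\<close>. Trading the harmonic number for a square root leaves a pure power sum
  later.\<close>

lemma one_plus_harm_le_sqrt: "1 + harm n \<le> 8/5 * sqrt (real (Suc n))"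
proof (induction n)
  case 0
  then show ?case by (simp add: harm_def)
next
  case (Suc n)
  show ?case
  proof (cases "n = 0")
    case True
    have "5/4 \<le> sqrt (2::real)" by (rule real_le_rsqrt) (simp add: power2_eq_square)
    then show ?thesis using True by (simp add: harm_def)
  next
    case False
    define x where "x = real (Suc n)"
    have x: "x \<ge> 2" using False by (simp add: x_def)
    have le: "sqrt (x + 1) + sqrt x \<le> 8/5 * x"
    proof -
      have *: "2 * x \<le> x\<^sup>2" using x by (simp add: power2_eq_square)
      \<comment> \<open>\<open>71/100\<close> and \<open>87/100\<close> round up
        \<open>1 / sqrt 2\<close> and \<open>sqrt 3 / 2\<close>, the worst ratios (at
        \<open>x = 2\<close>); their sum stays below \<open>8/5\<close>.\<close>
      have "x \<le> (71/100 * x)\<^sup>2" "x + 1 \<le> (87/100 * x)\<^sup>2"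
        unfolding power_mult_distrib using x * by (simp_all add: power2_eq_square[of "_ / _"])
      then have "sqrt x \<le> 71/100 * x" and "sqrt (x + 1) \<le> 87/100 * x"
        by (intro real_le_lsqrt; use x in linarith)+
      then show ?thesis using x by simp
    qed
    then have "1 / x \<le> 8/5 * (sqrt (x + 1) - sqrt x)"
    proof -
      have "(sqrt (x + 1) - sqrt x) * (sqrt (x + 1) + sqrt x) = 1"
        using x by (simp add: algebra_simps)
      then have "1 \<le> (sqrt (x + 1) - sqrt x) * (8/5 * x)"
        using mult_left_mono[OF le, of "sqrt (x + 1) - sqrt x"] by simp
      then show ?thesis using x by (simp add: field_simps)
    qed
    then show ?thesis
      using Suc by (simp add: harm_Suc x_def inverse_eq_divide algebra_simps)
  qed
qed

text \<open>A discrete integral comparison: each term after the first is at most the decrease of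
  \<open>k powr (- q) / q\<close>, which follows from \<open>1 + y \<le> exp y\<close> and
  \<open>ln y \<le> y - 1\<close>.\<close>

lemma sum_powr_le:
  fixes q :: real
  assumes "0 < q"
  shows "(\<Sum>k=1..n. real k powr (- q - 1)) \<le> 1 + 1 / q"
proof (cases "n = 0")
  case False
  \<comment> \<open>Strengthened by the remainder \<open>n powr (- q) / q\<close> so that the
    induction telescopes; at \<open>n = 1\<close> it is an equality.\<close>
  have "(\<Sum>k=1..n. real k powr (- q - 1)) \<le> 1 + 1 / q - real n powr (- q) / q" if "1 \<le> n" for n
    using that
  proof (induction n rule: dec_induct)
    case base
    then show ?case by simp
  next
    case (step n)
    have n: "real n > 0" using step by simp
    have "1 / real (Suc n) \<le> ln (real (Suc n) / real n)"
      using ln_le_minus_one[of "real n / real (Suc n)"] n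
      by (simp add: ln_div field_simps)
    then have "1 + q / real (Suc n) \<le> 1 + q * ln (real (Suc n) / real n)"
      using mult_left_mono[of _ _ q] assms by fastforce
    also have "\<dots> \<le> (real (Suc n) / real n) powr q"
      using n by (simp add: powr_def exp_ge_add_one_self)
    also have "\<dots> = real (Suc n) powr q * real n powr (- q)"
      using n by (simp add: powr_divide powr_minus field_simps)
    finally have "real (Suc n) powr (- q) * (1 + q / real (Suc n))
        \<le> real (Suc n) powr (- q) * (real (Suc n) powr q * real n powr (- q))"
      by (intro mult_left_mono) auto
    also have "\<dots> = real n powr (- q)"
      by (simp only: mult.assoc[symmetric] powr_add[symmetric]) simp
    finally have "real (Suc n) powr (- q) + q * real (Suc n) powr (- q - 1) \<le> real n powr (- q)"
      by (simp add: powr_diff distrib_left mult.commute)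
    then have "real (Suc n) powr (- q - 1) \<le> (real n powr (- q) - real (Suc n) powr (- q)) / q"
      using assms by (simp add: field_simps)
    then show ?case
      using step.IH by (simp add: diff_divide_distrib)
  qed
  from this[of n] False show ?thesis
    using assms by (smt (verit) One_nat_def divide_nonneg_nonneg less_one linorder_not_less powr_ge_zero)
qed (use assms in simp)

text \<open>The exponent is constant on blocks of length \<open>\<tau>\<close>. The range is
  enlarged to \<open>Suc n\<close> full blocks, and the geometric series over the blocks gives the
  factor 2.\<close>

lemma sum_half_power_div_le:
  assumes "0 < \<tau>"
  shows "(\<Sum>s\<le>n. (1/2::real) ^ (s div \<tau>)) \<le> 2 * real \<tau>"
proof -
  have block: "(\<Sum>s\<in>{m * \<tau>..<m * \<tau> + \<tau>}. (1/2::real) ^ (s div \<tau>)) = real \<tau> * (1/2) ^ m" for m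
  proof -
    have "(\<Sum>s\<in>{m * \<tau>..<m * \<tau> + \<tau>}. (1/2::real) ^ (s div \<tau>)) = (\<Sum>s\<in>{m * \<tau>..<m * \<tau> + \<tau>}. (1/2) ^ m)"
    proof (intro sum.cong refl arg_cong2[where f = power])
      fix s assume "s \<in> {m * \<tau>..<m * \<tau> + \<tau>}"
      then show "s div \<tau> = m"
        by (intro div_nat_eqI) (auto simp: mult.commute)
    qed
    then show ?thesis by simp
  qed
  have "(\<Sum>s\<le>n. (1/2::real) ^ (s div \<tau>)) \<le> (\<Sum>s<Suc n * \<tau>. (1/2) ^ (s div \<tau>))"
  proof (intro sum_mono2)
    have "Suc n \<le> Suc n * \<tau>" using assms by (cases \<tau>) auto
    then show "{..n} \<subseteq> {..<Suc n * \<tau>}" by force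
  qed auto
  also have "\<dots> = real \<tau> * (\<Sum>m<Suc n. (1/2) ^ m)"
    by (simp only: sum.nat_group[symmetric] block sum_distrib_left)
  also have "(\<Sum>m<Suc n. (1/2::real) ^ m) \<le> 2"
    by (subst geometric_sum) (auto simp: field_simps)
  finally show ?thesis
    using assms by (simp add: mult.commute mult_right_mono)
qed

text \<open>The convolution is exchanged with the outer sum: each \<open>j\<close> is then charged with the total
  mass \<open>2 \<tau>\<close> of the mixing weights.\<close>

lemma second_moment_recursion_bound:
  fixes s :: "nat \<Rightarrow> real" and a c :: real
  assumes a: "0 < a" "a < 1/2" and c: "0 \<le> c" and \<tau>: "0 < \<tau>"
    and s0: "s 0 = 0" and nonneg: "\<And>t. 0 \<le> s t"
    and step: "\<And>n. s (Suc n) \<le> (1 - a / real (Suc n))\<^sup>2 * s n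
      + 2 * c / real (Suc n) * (\<Sum>j\<le>n. (1/2) ^ ((n - j) div \<tau>) * ((1 + harm j) / real (Suc j)))"
  shows "s n \<le> c * (28 * real \<tau> / (1 - 2 * a)) / real (Suc n) powr a"
proof -
  define b where "b k = (1/2::real) ^ (k div \<tau>)" for k
  define g where "g j = (1 + harm j) / real (Suc j)" for j
  have g0: "0 \<le> g j" for j
    by (simp add: g_def harm_nonneg add_nonneg_nonneg)
  have b0: "0 \<le> b k" for k by (simp add: b_def)
  define R where "R n = (\<Sum>j\<le>n. b (n - j) * g j)" for n
  have R0: "0 \<le> R n" for n
    unfolding R_def using b0 g0 by (intro sum_nonneg) auto
  have step': "real (Suc (Suc n)) powr a * s (Suc n)
      \<le> real (Suc n) powr a * s n + 2 * c * sqrt 2 * (real (Suc n) powr (a - 1) * R n)" for n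
  proof -
    define q where "q = 1 - a / real (Suc n)"
    have q: "0 \<le> q" "q \<le> 1" using a by (auto simp: q_def field_simps)
    \<comment> \<open>One of the two factors \<open>q\<close> absorbs the growth of the weight; the
      other is bounded by 1.\<close>
    have "q * (q * real (Suc (Suc n)) powr a) \<le> 1 * real (Suc n) powr a"
      using one_minus_mult_powr_Suc_le[of "Suc n" a] a q
      by (intro mult_mono) (auto simp: q_def)
    then have 1: "real (Suc (Suc n)) powr a * (q\<^sup>2 * s n) \<le> real (Suc n) powr a * s n"
      using mult_right_mono[OF _ nonneg[of n]] by (fastforce simp: power2_eq_square mult_ac)
    \<comment> \<open>The shift of the weight in front of the noise costs \<open>2 powr a\<close>,
      at most \<open>sqrt 2\<close> because \<open>a < 1/2\<close>.\<close>
    have "real (Suc (Suc n)) powr a \<le> (2 * real (Suc n)) powr a"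
      using a by (intro powr_mono2) auto
    also have "\<dots> = 2 powr a * real (Suc n) powr a"
      by (rule powr_mult) 
    also have "2 powr a \<le> 2 powr (1/2)"
      using a by (intro powr_mono) auto
    finally have "real (Suc (Suc n)) powr a \<le> sqrt 2 * real (Suc n) powr a"
      by (simp add: powr_half_sqrt mult_right_mono)
    then have "real (Suc (Suc n)) powr a * (2 * c / real (Suc n) * R n)
        \<le> sqrt 2 * real (Suc n) powr a * (2 * c / real (Suc n) * R n)"
      using c R0 by (intro mult_right_mono) auto
    also have "\<dots> = 2 * c * sqrt 2 * (real (Suc n) powr (a - 1) * R n)"
      by (simp add: powr_diff)
    finally have 2: "real (Suc (Suc n)) powr a * (2 * c / real (Suc n) * R n)
        \<le> 2 * c * sqrt 2 * (real (Suc n) powr (a - 1) * R n)" .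
    have "real (Suc (Suc n)) powr a * s (Suc n)
        \<le> real (Suc (Suc n)) powr a * (q\<^sup>2 * s n + 2 * c / real (Suc n) * R n)"
      using step[of n] by (intro mult_left_mono) (auto simp: q_def R_def b_def g_def)
    with 1 2 show ?thesis by (simp add: distrib_left)
  qed
  have telescoped: "real (Suc n) powr a * s n \<le> 2 * c * sqrt 2 * (\<Sum>k<n. real (Suc k) powr (a - 1) * R k)" for n
  proof (induction n)
    case (Suc n)
    show ?case using step'[of n] Suc by (simp add: distrib_left)
  qed (simp add: s0)
  have "(\<Sum>k<n. real (Suc k) powr (a - 1) * R k)
      \<le> (\<Sum>k<n. \<Sum>j\<le>k. b (k - j) * (real (Suc j) powr (a - 1) * g j))"
  proof (rule sum_mono)
    fix k
    have "real (Suc k) powr (a - 1) * R k = (\<Sum>j\<le>k. b (k - j) * (real (Suc k) powr (a - 1) * g j))"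
      unfolding R_def sum_distrib_left by (simp add: mult_ac)
    \<comment> \<open>Since \<open>a - 1 < 0\<close>, the weight may be moved from \<open>k\<close>
      to the earlier index \<open>j\<close>; then only \<open>b (k - j)\<close> depends on
      \<open>k\<close>, and exchanging the sums isolates it.\<close>
    also have "\<dots> \<le> (\<Sum>j\<le>k. b (k - j) * (real (Suc j) powr (a - 1) * g j))"
      using a b0 g0 by (intro sum_mono mult_left_mono mult_right_mono powr_mono2') auto
    finally show "real (Suc k) powr (a - 1) * R k
        \<le> (\<Sum>j\<le>k. b (k - j) * (real (Suc j) powr (a - 1) * g j))" .
  qed
  also have "(\<Sum>k<n. \<Sum>j\<le>k. b (k - j) * (real (Suc j) powr (a - 1) * g j))
      = (\<Sum>k<n. \<Sum>j | j < n \<and> j \<le> k. b (k - j) * (real (Suc j) powr (a - 1) * g j))"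
    by (intro sum.cong) auto
  also have "\<dots> = (\<Sum>j<n. \<Sum>k | k < n \<and> j \<le> k. b (k - j) * (real (Suc j) powr (a - 1) * g j))"
    using sum.swap_restrict[of "{..<n}" "{..<n}" "\<lambda>k j. b (k - j) * (real (Suc j) powr (a - 1) * g j)" "\<lambda>k j. j \<le> k"]
    by simp
  also have "\<dots> \<le> (\<Sum>j<n. 2 * real \<tau> * (8/5 * real (Suc j) powr (- (1/2 - a) - 1)))"
  proof (rule sum_mono)
    fix j
    have "(\<Sum>k | k < n \<and> j \<le> k. b (k - j)) = (\<Sum>s\<in>(\<lambda>k. k - j) ` {k. k < n \<and> j \<le> k}. b s)"
      by (subst sum.reindex) (auto simp: inj_on_def)
    also have "\<dots> \<le> (\<Sum>s\<le>n. b s)"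
      using b0 by (intro sum_mono2) auto
    also have "\<dots> \<le> 2 * real \<tau>"
      using sum_half_power_div_le[OF \<tau>] by (simp add: b_def)
    finally have 1: "(\<Sum>k | k < n \<and> j \<le> k. b (k - j)) \<le> 2 * real \<tau>" .
    have "real (Suc j) powr (a - 1) * g j
        \<le> real (Suc j) powr (a - 1) * (8/5 * sqrt (real (Suc j)) / real (Suc j))"
      unfolding g_def using one_plus_harm_le_sqrt[of j] by (intro mult_left_mono divide_right_mono) auto
    also have "8/5 * sqrt (real (Suc j)) / real (Suc j) = 8/5 * real (Suc j) powr (1/2 - 1)"
      by (simp only: powr_diff powr_half_sqrt powr_one of_nat_0_le_iff times_divide_eq_right)
    also have "real (Suc j) powr (a - 1) * (8/5 * real (Suc j) powr (1/2 - 1))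
        = 8/5 * real (Suc j) powr ((a - 1) + (1/2 - 1))"
      by (simp only: powr_add mult_ac)
    \<comment> \<open>The exponent \<open>a - 3/2\<close>, written as \<open>sum_powr_le\<close>
      expects it with \<open>q = 1/2 - a > 0\<close>.\<close>
    also have "(a - 1) + (1/2 - 1) = - (1/2 - a) - 1"
      by simp
    finally have 2: "real (Suc j) powr (a - 1) * g j \<le> 8/5 * real (Suc j) powr (- (1/2 - a) - 1)" .
    have "(\<Sum>k | k < n \<and> j \<le> k. b (k - j) * (real (Suc j) powr (a - 1) * g j))
        = (\<Sum>k | k < n \<and> j \<le> k. b (k - j)) * (real (Suc j) powr (a - 1) * g j)"
      by (simp add: sum_distrib_right)
    also have "\<dots> \<le> 2 * real \<tau> * (8/5 * real (Suc j) powr (- (1/2 - a) - 1))"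
      using mult_mono[OF 1 2] g0 by simp
    finally show "(\<Sum>k | k < n \<and> j \<le> k. b (k - j) * (real (Suc j) powr (a - 1) * g j))
        \<le> 2 * real \<tau> * (8/5 * real (Suc j) powr (- (1/2 - a) - 1))" .
  qed
  also have "\<dots> = 16/5 * real \<tau> * (\<Sum>k=1..n. real k powr (- (1/2 - a) - 1))"
    unfolding sum_distrib_left by (simp add: sum.atLeast1_atMost_eq mult_ac)
  also have "\<dots> \<le> 16/5 * real \<tau> * (3 / (1 - 2 * a))"
  proof (intro mult_left_mono)
    have "(\<Sum>k=1..n. real k powr (- (1/2 - a) - 1)) \<le> 1 + 1 / (1/2 - a)"
      using a by (intro sum_powr_le) auto
    also have "\<dots> \<le> 3 / (1 - 2 * a)"
      using a by (simp add: field_simps)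
    finally show "(\<Sum>k=1..n. real k powr (- (1/2 - a) - 1)) \<le> 3 / (1 - 2 * a)" .
  qed auto
  finally have "2 * c * sqrt 2 * (\<Sum>k<n. real (Suc k) powr (a - 1) * R k)
      \<le> 2 * c * sqrt 2 * (16/5 * real \<tau> * (3 / (1 - 2 * a)))"
    by (rule mult_left_mono) (use c in simp)
  then have "real (Suc n) powr a * s n \<le> 2 * c * sqrt 2 * (16/5 * real \<tau> * (3 / (1 - 2 * a)))"
    by (rule order_trans[OF telescoped])
  also have "\<dots> = (96/5 * sqrt 2) * (c * real \<tau> / (1 - 2 * a))"
    by simp
  also have "\<dots> \<le> 28 * (c * real \<tau> / (1 - 2 * a))"
  proof (intro mult_right_mono)
    \<comment> \<open>\<open>35/24\<close> is the number for which
      \<open>96/5 * 35/24 = 28\<close>.\<close>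
    have "sqrt 2 \<le> (35/24::real)"
      by (intro real_le_lsqrt) (auto simp: power2_eq_square)
    then show "96/5 * sqrt 2 \<le> (28::real)" by simp
  qed (use a c in auto)
  finally have "s n * real (Suc n) powr a \<le> c * (28 * real \<tau> / (1 - 2 * a))"
    by (simp add: mult_ac)
  moreover have "0 < real (Suc n) powr a" by simp
  ultimately show ?thesis
    by (simp only: pos_le_divide_eq)
qed

subsection \<open>Strong measurability\<close>

text \<open>The dense set \<open>D\<close> may leave \<open>S\<close>, so the property passes to
  subsets with the same \<open>D\<close>.\<close>

definition separable_set :: "'b::metric_space set \<Rightarrow> bool" where
  "separable_set S \<longleftrightarrow> (\<exists>D. countable D \<and> S \<subseteq> closure D)"

lemma strongly_measurable_imp_borel_measurable:
  fixes f :: "'a \<Rightarrow> 'b::metric_space"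
  assumes "strongly_measurable M f"
  shows "f \<in> borel_measurable M"
proof -
  obtain s where s: "\<And>i::nat. simple_function M (s i)"
    "\<And>x. x \<in> space M \<Longrightarrow> (\<lambda>i. s i x) \<longlonglongrightarrow> f x"
    using assms unfolding strongly_measurable_def by blast
  show ?thesis
    by (rule borel_measurable_LIMSEQ_metric[of s]) (auto intro: s borel_measurable_simple_function)
qed

text \<open>The finite ranges of the approximants have a countable union, and the limits lie in its
  closure. Together with Borel measurability this characterises strong measurability
  (Pettis).\<close>

lemma strongly_measurable_imp_separable_range:
  fixes f :: "'a \<Rightarrow> 'b::metric_space"
  assumes "strongly_measurable M f"
  shows "separable_set (f ` space M)"
proof -
  obtain s where s: "\<And>i::nat. simple_function M (s i)"
    "\<And>x. x \<in> space M \<Longrightarrow> (\<lambda>i. s i x) \<longlonglongrightarrow> f x"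
    using assms unfolding strongly_measurable_def by blast
  have "countable (\<Union>i. s i ` space M)"
    using s(1) by (auto simp: simple_function_def intro: countable_finite)
  moreover have "f ` space M \<subseteq> closure (\<Union>i. s i ` space M)"
  proof safe
    fix x assume "x \<in> space M"
    with s(2) show "f x \<in> closure (\<Union>i. s i ` space M)"
      unfolding closure_sequential by (intro exI[of _ "\<lambda>i. s i x"]) auto
  qed
  ultimately show ?thesis
    unfolding separable_set_def by blast
qed

text \<open>The approximants map \<open>x\<close> to the first of the points \<open>d 0, \<dots>, d n\<close> that is
  nearest to \<open>f x\<close>.\<close>

lemma strongly_measurableI:
  fixes f :: "'a \<Rightarrow> 'b::metric_space"
  assumes f [measurable]: "f \<in> borel_measurable M" and sep: "separable_set (f ` space M)"
  shows "strongly_measurable M f"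
proof (cases "space M = {}")
  \<comment> \<open>Treated apart because \<open>D\<close> may then be empty, while the enumeration
    \<open>d\<close> needs a point.\<close>
  case True
  then have "simple_function M f" by (simp add: simple_function_def)
  then show ?thesis
    unfolding strongly_measurable_def by (intro exI[of _ "\<lambda>_. f"]) auto
next
  case False
  obtain D where D: "countable D" "f ` space M \<subseteq> closure D"
    using sep unfolding separable_set_def by blast
  then have "D \<noteq> {}" using False by auto
  then obtain d :: "nat \<Rightarrow> 'b" where d: "range d = D"
    using D(1) by (metis range_from_nat_into)
  define m where "m n x = (LEAST i. i \<le> n \<and> (\<forall>j\<le>n. dist (f x) (d i) \<le> dist (f x) (d j)))" for n x
  have m: "m n x \<le> n \<and> (\<forall>j\<le>n. dist (f x) (d (m n x)) \<le> dist (f x) (d j))" for n x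
    unfolding m_def
  proof (rule LeastI_ex)
    have "\<exists>i\<in>{..n}. \<forall>j\<in>{..n}. dist (f x) (d i) \<le> dist (f x) (d j)"
      using ex_is_arg_min_if_finite[of "{..n}" "\<lambda>i. dist (f x) (d i)"]
      by (auto simp: is_arg_min_linorder)
    then show "\<exists>i. i \<le> n \<and> (\<forall>j\<le>n. dist (f x) (d i) \<le> dist (f x) (d j))" by auto
  qed
  have [measurable]: "(\<lambda>x. dist (f x) (d i)) \<in> borel_measurable M" for i
    by (rule measurable_compose[OF f]) (intro borel_measurable_continuous_onI continuous_intros)
  \<comment> \<open>The least index satisfying finitely many comparisons of real measurable
    functions depends measurably on \<open>x\<close>.\<close>
  have meas [measurable]: "m n \<in> measurable M (count_space UNIV)" for n
    unfolding m_def by measurable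
  have "simple_function M (\<lambda>x. d (m n x))" for n
  proof -
    have "m n ` space M \<subseteq> {..n}" using m by auto
    then have "finite (m n ` space M)" by (rule finite_subset) simp
    then have "simple_function M (m n)"
      using meas[of n] by (auto simp: simple_function_def intro!: measurable_sets[OF meas])
    from simple_function_compose1[OF this] show ?thesis .
  qed
  moreover have "(\<lambda>n. d (m n x)) \<longlonglongrightarrow> f x" if "x \<in> space M" for x
  proof (rule metric_LIMSEQ_I)
    fix e :: real assume "0 < e"
    moreover have "f x \<in> closure D" using D(2) that by auto
    ultimately obtain y where "y \<in> D" "dist y (f x) < e"
      unfolding closure_approachable by auto
    then obtain i where i: "dist (f x) (d i) < e"
      unfolding d[symmetric] by (auto simp: dist_commute)
    have "dist (d (m n x)) (f x) < e" if "i \<le> n" for n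
      using m[of n x] that i by (metis dist_commute le_less_trans)
    then show "\<exists>N. \<forall>n\<ge>N. dist (d (m n x)) (f x) < e" by blast
  qed
  ultimately show ?thesis
    unfolding strongly_measurable_def by (intro exI[of _ "\<lambda>n x. d (m n x)"]) auto
qed

text \<open>Borel measurability and separability of the range both survive pointwise limits, which
  avoids a diagonal choice among simple approximants.\<close>

lemma strongly_measurable_LIMSEQ:
  fixes f :: "'a \<Rightarrow> 'b::metric_space"
  assumes g: "\<And>i::nat. strongly_measurable M (g i)"
    and lim: "\<And>x. x \<in> space M \<Longrightarrow> (\<lambda>i. g i x) \<longlonglongrightarrow> f x"
  shows "strongly_measurable M f"
proof (rule strongly_measurableI)
  show "f \<in> borel_measurable M"
    by (rule borel_measurable_LIMSEQ_metric[of g])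
      (auto intro: strongly_measurable_imp_borel_measurable g lim)
  have "\<forall>i. \<exists>D. countable D \<and> g i ` space M \<subseteq> closure D"
    using strongly_measurable_imp_separable_range[OF g] by (simp add: separable_set_def)
  then obtain D where D: "\<And>i. countable (D i)" "\<And>i. g i ` space M \<subseteq> closure (D i)"
    by metis
  have "f ` space M \<subseteq> closure (closure (\<Union>i. D i))"
  proof safe
    fix x assume x: "x \<in> space M"
    have "closure (D i) \<subseteq> closure (\<Union>i. D i)" for i
      by (intro closure_mono) auto
    then have "\<forall>i. g i x \<in> closure (\<Union>i. D i)"
      using D(2) x by blast
    with lim[OF x] show "f x \<in> closure (closure (\<Union>i. D i))"
      unfolding closure_sequential[of _ "closure (\<Union>i. D i)"]
      by (intro exI[of _ "\<lambda>i. g i x"]) auto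
  qed
  then show "separable_set (f ` space M)"
    unfolding separable_set_def using D(1) by (intro exI[of _ "\<Union>i. D i"]) auto
qed

lemma simple_function_imp_strongly_measurable:
  "simple_function M f \<Longrightarrow> strongly_measurable M f"
  unfolding strongly_measurable_def by (intro exI[of _ "\<lambda>_. f"]) auto

section \<open>Closure properties of strong measurability\<close>

lemma strongly_measurable_compose_measurable:
  fixes f :: "'b \<Rightarrow> 'c::metric_space"
  assumes g: "g \<in> M \<rightarrow>\<^sub>M N" and f: "strongly_measurable N f"
  shows "strongly_measurable M (\<lambda>x. f (g x))"
proof (rule strongly_measurableI)
  show "(\<lambda>x. f (g x)) \<in> borel_measurable M"
    using g strongly_measurable_imp_borel_measurable[OF f] by (rule measurable_compose)
  obtain D where "countable D" "f ` space N \<subseteq> closure D"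
    using strongly_measurable_imp_separable_range[OF f] unfolding separable_set_def by blast
  then show "separable_set ((\<lambda>x. f (g x)) ` space M)"
    using measurable_space[OF g] unfolding separable_set_def by blast
qed

lemma strongly_measurable_cong:
  "M = N \<Longrightarrow> (\<And>x. x \<in> space N \<Longrightarrow> f x = g x) \<Longrightarrow> strongly_measurable M f \<longleftrightarrow> strongly_measurable N g"
  by (simp add: strongly_measurable_def)

lemma strongly_measurable_cong_sets:
  "sets M = sets N \<Longrightarrow> strongly_measurable M f \<longleftrightarrow> strongly_measurable N f"
  using sets_eq_imp_space_eq[of M N] by (simp add: strongly_measurable_def simple_function_def)

lemma strongly_measurable_lincomb:
  fixes f g :: "'a \<Rightarrow> 'b::real_normed_vector"
  assumes "strongly_measurable M f" "strongly_measurable M g"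
  shows "strongly_measurable M (\<lambda>x. a *\<^sub>R f x + b *\<^sub>R g x)"
proof -
  obtain s t where "\<And>i::nat. simple_function M (s i)" "\<And>i::nat. simple_function M (t i)"
    "\<And>x. x \<in> space M \<Longrightarrow> (\<lambda>i. s i x) \<longlonglongrightarrow> f x"
    "\<And>x. x \<in> space M \<Longrightarrow> (\<lambda>i. t i x) \<longlonglongrightarrow> g x"
    using assms unfolding strongly_measurable_def by metis
  then show ?thesis
    unfolding strongly_measurable_def
    by (intro exI[of _ "\<lambda>i x. a *\<^sub>R s i x + b *\<^sub>R t i x"])
      (auto intro!: tendsto_intros simple_function_compose2[where h = "\<lambda>u v. a *\<^sub>R u + b *\<^sub>R v"])
qed

lemma strongly_measurable_add:
  fixes f g :: "'a \<Rightarrow> 'b::real_normed_vector"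
  assumes "strongly_measurable M f" "strongly_measurable M g"
  shows "strongly_measurable M (\<lambda>x. f x + g x)"
  using strongly_measurable_lincomb[OF assms, of 1 1] by simp

lemma strongly_measurable_diff:
  fixes f g :: "'a \<Rightarrow> 'b::real_normed_vector"
  assumes "strongly_measurable M f" "strongly_measurable M g"
  shows "strongly_measurable M (\<lambda>x. f x - g x)"
  using strongly_measurable_lincomb[OF assms, of 1 "-1"] by simp

lemma strongly_measurable_scaleR:
  fixes f :: "'a \<Rightarrow> 'b::real_normed_vector"
  assumes "strongly_measurable M f"
  shows "strongly_measurable M (\<lambda>x. a *\<^sub>R f x)"
  using strongly_measurable_lincomb[OF assms assms, of a 0] by simp

lemma strongly_measurable_sum:
  fixes f :: "'i \<Rightarrow> 'a \<Rightarrow> 'b::real_normed_vector"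
  assumes "\<And>i. i \<in> I \<Longrightarrow> strongly_measurable M (f i)"
  shows "strongly_measurable M (\<lambda>x. \<Sum>i\<in>I. f i x)"
  using assms
  by (induction I rule: infinite_finite_induct)
    (auto intro: strongly_measurable_add simple_function_imp_strongly_measurable)

lemma strongly_measurable_indicator_scaleR:
  fixes f :: "'a \<Rightarrow> 'b::real_normed_vector"
  assumes "S \<in> sets M" "strongly_measurable M f"
  shows "strongly_measurable M (\<lambda>x. indicator S x *\<^sub>R f x)"
proof -
  obtain s where "\<And>i::nat. simple_function M (s i)" "\<And>x. x \<in> space M \<Longrightarrow> (\<lambda>i. s i x) \<longlonglongrightarrow> f x"
    using assms(2) unfolding strongly_measurable_def by metis
  with assms(1) show ?thesis
    unfolding strongly_measurable_def
    by (intro exI[of _ "\<lambda>i x. indicator S x *\<^sub>R s i x"]) (auto intro!: tendsto_intros)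
qed

text \<open>\<open>T\<close> is only assumed measurable at each fixed vector, not in operator norm.
  For simple \<open>f\<close> the result is a finite sum over the values of \<open>f\<close>; the
  general case is a limit, by continuity of each \<open>T x\<close>.\<close>

lemma strongly_measurable_blinfun_apply:
  fixes T :: "'a \<Rightarrow> 'b::real_normed_vector \<Rightarrow>\<^sub>L 'c::real_normed_vector"
  assumes T: "\<And>v. strongly_measurable M (\<lambda>x. T x v)" and f: "strongly_measurable M f"
  shows "strongly_measurable M (\<lambda>x. T x (f x))"
proof -
  obtain s where s: "\<And>i::nat. simple_function M (s i)"
    "\<And>x. x \<in> space M \<Longrightarrow> (\<lambda>i. s i x) \<longlonglongrightarrow> f x"
    using f unfolding strongly_measurable_def by metis
  show ?thesis
  proof (rule strongly_measurable_LIMSEQ)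
    fix i
    have fin: "finite (s i ` space M)"
      using s(1) by (simp add: simple_function_def)
    have "strongly_measurable M
        (\<lambda>x. \<Sum>v\<in>s i ` space M. indicator (s i -` {v} \<inter> space M) x *\<^sub>R T x v)"
      using s(1)[of i] T
      by (intro strongly_measurable_sum strongly_measurable_indicator_scaleR simple_functionD)
    moreover have "(\<Sum>v\<in>s i ` space M. indicator (s i -` {v} \<inter> space M) x *\<^sub>R T x v) = T x (s i x)"
      if "x \<in> space M" for x
    proof -
      have "(\<Sum>v\<in>s i ` space M. indicator (s i -` {v} \<inter> space M) x *\<^sub>R T x v)
          = (\<Sum>v\<in>s i ` space M. if v = s i x then T x v else 0)"
        using that by (intro sum.cong) (auto simp: indicator_def)
      also have "\<dots> = T x (s i x)"
        using fin that by (simp add: sum.delta)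
      finally show ?thesis .
    qed
    ultimately show "strongly_measurable M (\<lambda>x. T x (s i x))"
      by (simp cong: strongly_measurable_cong)
  qed (use s(2) in \<open>auto intro!: tendsto_intros\<close>)
qed

text \<open>In a non-separable space a pair of Borel maps need not be jointly Borel, so both
  arguments are approximated by simple functions.\<close>

lemma borel_measurable_inner_strongly_measurable:
  fixes f g :: "'a \<Rightarrow> 'b::real_inner"
  assumes "strongly_measurable M f" "strongly_measurable M g"
  shows "(\<lambda>x. f x \<bullet> g x) \<in> borel_measurable M"
proof -
  obtain s t where s: "\<And>i::nat. simple_function M (s i)" "\<And>i::nat. simple_function M (t i)"
    "\<And>x. x \<in> space M \<Longrightarrow> (\<lambda>i. s i x) \<longlonglongrightarrow> f x"
    "\<And>x. x \<in> space M \<Longrightarrow> (\<lambda>i. t i x) \<longlonglongrightarrow> g x"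
    using assms unfolding strongly_measurable_def by metis
  have "simple_function M (\<lambda>x. s i x \<bullet> t i x)" for i
    using simple_function_compose2[OF s(1,2), of "(\<bullet>)" i i] by simp
  then have "(\<lambda>x. s i x \<bullet> t i x) \<in> borel_measurable M" for i
    by (rule borel_measurable_simple_function)
  moreover have "(\<lambda>i. s i x \<bullet> t i x) \<longlonglongrightarrow> f x \<bullet> g x" if "x \<in> space M" for x
    using s(3,4)[OF that] by (rule tendsto_inner)
  ultimately show ?thesis
    by (rule borel_measurable_LIMSEQ_real[rotated])
qed

text \<open>Turns a mean in \<open>W\<close> into means of real functions, so that the chain
  argument handles scalar integrals only. Cauchy-Schwarz carries the \<open>L^1\<close>
  approximation over.\<close>

lemma has_bochner_integral_inner_right:
  fixes f :: "'a \<Rightarrow> 'b::real_inner"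
  assumes "has_bochner_int M f x"
  shows "has_bochner_integral M (\<lambda>y. u \<bullet> f y) (u \<bullet> x)"
proof -
  obtain s where sm: "strongly_measurable M f"
    and s: "\<And>i::nat. Bochner_Integration.simple_bochner_integrable M (s i)"
    and L1: "(\<lambda>i. \<integral>\<^sup>+y. ennreal (norm (f y - s i y)) \<partial>M) \<longlonglongrightarrow> 0"
    and lim: "(\<lambda>i. Bochner_Integration.simple_bochner_integral M (s i)) \<longlonglongrightarrow> x"
    using assms by (auto simp: has_bochner_int_def)
  have simp_s: "simple_function M (s i)" for i
    using s by (simp add: simple_bochner_integrable.simps)
  show ?thesis
  proof (rule has_bochner_integral.intros[where s = "\<lambda>i y. u \<bullet> s i y"])
    show "(\<lambda>y. u \<bullet> f y) \<in> borel_measurable M"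
      by (intro borel_measurable_inner_strongly_measurable sm
          simple_function_imp_strongly_measurable simple_function_const)
    show "Bochner_Integration.simple_bochner_integrable M (\<lambda>y. u \<bullet> s i y)" for i
      using simple_bochner_integrable_compose2[of "\<lambda>a b. u \<bullet> a" M "s i" "s i"] s by simp
    show "(\<lambda>i. \<integral>\<^sup>+ y. norm (u \<bullet> f y - u \<bullet> s i y) \<partial>M) \<longlonglongrightarrow> 0"
    proof (rule tendsto_sandwich[where f = "\<lambda>_. 0"])
      show "\<forall>\<^sub>F i in sequentially. (\<integral>\<^sup>+ y. norm (u \<bullet> f y - u \<bullet> s i y) \<partial>M)
          \<le> norm u * (\<integral>\<^sup>+ y. norm (f y - s i y) \<partial>M)"
      proof (intro always_eventually allI)
        fix i
        have "(\<lambda>y. norm (f y - s i y)) \<in> borel_measurable M"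
          using strongly_measurable_diff[OF sm simple_function_imp_strongly_measurable[OF simp_s]]
          by (intro measurable_compose[OF strongly_measurable_imp_borel_measurable borel_measurable_norm]) auto
        then have "(\<integral>\<^sup>+ y. norm u * norm (f y - s i y) \<partial>M) = norm u * (\<integral>\<^sup>+ y. norm (f y - s i y) \<partial>M)"
          by (simp add: ennreal_mult nn_integral_cmult)
        moreover have "(\<integral>\<^sup>+ y. norm (u \<bullet> f y - u \<bullet> s i y) \<partial>M) \<le> (\<integral>\<^sup>+ y. norm u * norm (f y - s i y) \<partial>M)"
          using Cauchy_Schwarz_ineq2
          by (intro nn_integral_mono) (auto simp: inner_diff_right[symmetric] intro!: ennreal_leI)
        ultimately show "(\<integral>\<^sup>+ y. norm (u \<bullet> f y - u \<bullet> s i y) \<partial>M)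
            \<le> norm u * (\<integral>\<^sup>+ y. norm (f y - s i y) \<partial>M)" by simp
      qed
      show "(\<lambda>i. norm u * (\<integral>\<^sup>+ y. norm (f y - s i y) \<partial>M)) \<longlonglongrightarrow> 0"
        using ennreal_tendsto_cmult[OF _ L1, of "norm u"] by simp
    qed auto
    have "linear (\<lambda>v. u \<bullet> v)"
      by (intro bounded_linear.linear bounded_linear_inner_right)
    then have "Bochner_Integration.simple_bochner_integral M (\<lambda>y. u \<bullet> s i y) = u \<bullet> Bochner_Integration.simple_bochner_integral M (s i)" for i
      using s by (intro simple_bochner_integral_linear)
    then show "(\<lambda>i. Bochner_Integration.simple_bochner_integral M (\<lambda>y. u \<bullet> s i y)) \<longlonglongrightarrow> u \<bullet> x"
      using lim by (auto intro!: tendsto_intros)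
  qed
qed

subsection \<open>Mixing of the kernel\<close>

lemma measurable_markov_kernel:
  "markov_kernel Z P \<Longrightarrow> P \<in> Z \<rightarrow>\<^sub>M subprob_algebra Z"
  unfolding markov_kernel_def by (rule measurable_prob_algebraD)

lemma measurable_kernel_pow_prob_algebra:
  assumes "markov_kernel Z P"
  shows "kernel_pow Z P t \<in> Z \<rightarrow>\<^sub>M prob_algebra Z"
proof (induction t)
  case 0
  then show ?case by (simp add: measurable_return_prob_space)
next
  case (Suc t)
  then have "(\<lambda>z. kernel_pow Z P t z \<bind> P) \<in> Z \<rightarrow>\<^sub>M prob_algebra Z"
    using assms unfolding markov_kernel_def by (rule measurable_bind_prob_space)
  then show ?case by simp
qed

lemma measurable_kernel_pow:
  "markov_kernel Z P \<Longrightarrow> kernel_pow Z P t \<in> Z \<rightarrow>\<^sub>M subprob_algebra Z"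
  by (intro measurable_prob_algebraD measurable_kernel_pow_prob_algebra)

lemma kernel_pow_space:
  assumes "markov_kernel Z P" "x \<in> space Z"
  shows "prob_space (kernel_pow Z P t x)" "sets (kernel_pow Z P t x) = sets Z"
    "space (kernel_pow Z P t x) = space Z"
proof -
  have "kernel_pow Z P t x \<in> space (prob_algebra Z)"
    using measurable_space[OF measurable_kernel_pow_prob_algebra[OF assms(1)] assms(2)] .
  then show "prob_space (kernel_pow Z P t x)" "sets (kernel_pow Z P t x) = sets Z"
    "space (kernel_pow Z P t x) = space Z"
    by (auto simp: space_prob_algebra dest: sets_eq_imp_space_eq)
qed

text \<open>Chapman-Kolmogorov. The induction runs over \<open>t\<close> because
  \<open>kernel_pow\<close> appends its last step on the right.\<close>

lemma kernel_pow_add: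
  assumes P: "markov_kernel Z P" and x: "x \<in> space Z"
  shows "kernel_pow Z P (s + t) x = kernel_pow Z P s x \<bind> kernel_pow Z P t"
proof (induction t)
  case 0
  have "kernel_pow Z P 0 = return Z" by auto
  then show ?case
    using kernel_pow_space(2)[OF assms] by (simp only: bind_return'' add_0_right)
next
  case (Suc t)
  have "kernel_pow Z P t \<in> kernel_pow Z P s x \<rightarrow>\<^sub>M subprob_algebra Z"
    using measurable_kernel_pow[OF P, of t] measurable_cong_sets[OF kernel_pow_space(2)[OF assms] refl]
    by blast
  from bind_assoc[OF this measurable_markov_kernel[OF P]] Suc show ?case
    by simp
qed

lemma stationary_kernel_pow:
  assumes P: "markov_kernel Z P" and st: "stationary Z P \<rho>"
  shows "\<rho> \<bind> kernel_pow Z P t = \<rho>"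
proof (induction t)
  case 0
  have "kernel_pow Z P 0 = return Z" by auto
  then show ?case
    using st by (simp only: bind_return'' stationary_def)
next
  case (Suc t)
  have "sets \<rho> = sets Z" using st by (simp add: stationary_def)
  then have "kernel_pow Z P t \<in> \<rho> \<rightarrow>\<^sub>M subprob_algebra Z"
    using measurable_kernel_pow[OF P, of t] measurable_cong_sets[of \<rho> Z] by blast
  from bind_assoc[OF this measurable_markov_kernel[OF P]] Suc st show ?case
    by (simp add: stationary_def)
qed

lemma
  fixes f :: "'z \<Rightarrow> real"
  assumes P: "markov_kernel Z P" and f: "f \<in> borel_measurable Z"
    and bnd: "\<And>x. x \<in> space Z \<Longrightarrow> \<bar>f x\<bar> \<le> b"
  shows borel_measurable_integral_kernel_pow:
      "(\<lambda>x. \<integral>y. f y \<partial>kernel_pow Z P t x) \<in> borel_measurable Z" (is ?M)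
    and abs_integral_kernel_pow_le: "x \<in> space Z \<Longrightarrow> \<bar>\<integral>y. f y \<partial>kernel_pow Z P t x\<bar> \<le> b"
proof -
  show ?M
    by (rule measurable_compose[OF measurable_kernel_pow[OF P] integral_measurable_subprob_algebra[OF f]])
  assume x: "x \<in> space Z"
  interpret K: prob_space "kernel_pow Z P t x"
    by (rule kernel_pow_space(1)[OF P x])
  note sp = kernel_pow_space(2,3)[OF P x]
  have int: "integrable (kernel_pow Z P t x) f"
    using f bnd by (intro K.integrable_const_bound[where B = b])
      (auto simp: sp intro!: AE_I2 cong: measurable_cong_sets)
  have "\<bar>\<integral>y. f y \<partial>kernel_pow Z P t x\<bar> \<le> (\<integral>y. \<bar>f y\<bar> \<partial>kernel_pow Z P t x)"
    by (rule integral_abs_bound)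
  also have "\<dots> \<le> (\<integral>y. b \<partial>kernel_pow Z P t x)"
    using int bnd by (intro integral_mono) (auto simp: sp)
  also have "\<dots> = b" by (simp add: K.prob_space)
  finally show "\<bar>\<integral>y. f y \<partial>kernel_pow Z P t x\<bar> \<le> b" .
qed

lemma integral_bind_kernel_pow:
  fixes f :: "'z \<Rightarrow> real"
  assumes P: "markov_kernel Z P" and f: "f \<in> borel_measurable Z"
    and bnd: "\<And>x. x \<in> space Z \<Longrightarrow> \<bar>f x\<bar> \<le> b"
    and \<mu>: "prob_space \<mu>" "sets \<mu> = sets Z"
  shows "(\<integral>y. f y \<partial>(\<mu> \<bind> kernel_pow Z P t)) = (\<integral>x. \<integral>y. f y \<partial>kernel_pow Z P t x \<partial>\<mu>)"
proof (rule integral_bind[where B = b and B' = 1, OF f bnd])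
  interpret prob_space \<mu> by fact
  show "finite_measure \<mu>" by unfold_locales
  show "kernel_pow Z P t \<in> \<mu> \<rightarrow>\<^sub>M subprob_algebra Z"
    using measurable_kernel_pow[OF P, of t] measurable_cong_sets[OF \<mu>(2) refl] by blast
  show "AE x in \<mu>. emeasure (kernel_pow Z P t x) (space (kernel_pow Z P t x)) \<le> ennreal 1"
    using prob_space.emeasure_space_1[OF kernel_pow_space(1)[OF P]] sets_eq_imp_space_eq[OF \<mu>(2)]
    by (intro AE_I2) auto
qed

section \<open>Total variation and integrals of bounded functions\<close>

text \<open>The layer cake formula reduces the claim to the superlevel sets of \<open>g\<close>.\<close>

lemma integral_le_of_measure_le:
  fixes g :: "'a \<Rightarrow> real"
  assumes \<mu>: "prob_space \<mu>" and \<nu>: "prob_space \<nu>" and sets: "sets \<mu> = sets \<nu>"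
    and g: "g \<in> borel_measurable \<mu>" and bnd: "\<And>x. x \<in> space \<mu> \<Longrightarrow> 0 \<le> g x \<and> g x \<le> c"
    and le: "\<And>S. S \<in> sets \<mu> \<Longrightarrow> measure \<mu> S \<le> measure \<nu> S + d" and "0 \<le> d"
  shows "(\<integral>x. g x \<partial>\<mu>) \<le> (\<integral>x. g x \<partial>\<nu>) + d * c"
proof -
  interpret m: prob_space \<mu> by fact
  interpret n: prob_space \<nu> by fact
  have sp: "space \<mu> = space \<nu>" using sets by (rule sets_eq_imp_space_eq)
  have "0 \<le> c" using bnd m.not_empty by force
  have layer: "(\<integral>\<^sup>+x. ennreal (g x) \<partial>N)
      = (\<integral>\<^sup>+r. emeasure N {x\<in>space N. 0 \<le> r \<and> r < g x} \<partial>lborel)"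
    if "prob_space N" "sets N = sets \<mu>" for N
  proof -
    interpret l: prob_space N by fact
    interpret pair_sigma_finite N lborel ..
    have [measurable]: "g \<in> borel_measurable N"
      using g that(2) by (simp cong: measurable_cong_sets)
    have spl: "space N = space \<mu>" using that(2) by (rule sets_eq_imp_space_eq)
    define E where "E = {p \<in> space (N \<Otimes>\<^sub>M lborel). 0 \<le> snd p \<and> snd p < g (fst p)}"
    have [measurable]: "E \<in> sets (N \<Otimes>\<^sub>M lborel)"
      unfolding E_def by measurable
    have "(\<integral>\<^sup>+x. ennreal (g x) \<partial>N) = (\<integral>\<^sup>+x. \<integral>\<^sup>+r. indicator E (x, r) \<partial>lborel \<partial>N)"
    proof (rule nn_integral_cong)
      fix x assume x: "x \<in> space N"
      then have "(\<integral>\<^sup>+r. indicator E (x, r) \<partial>lborel) = (\<integral>\<^sup>+r. indicator {0..<g x} r \<partial>lborel)"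
        by (intro nn_integral_cong) (auto simp: E_def space_pair_measure indicator_def)
      then show "ennreal (g x) = (\<integral>\<^sup>+r. indicator E (x, r) \<partial>lborel)"
        using bnd x spl by simp
    qed
    also have "\<dots> = (\<integral>\<^sup>+r. \<integral>\<^sup>+x. indicator E (x, r) \<partial>N \<partial>lborel)"
      by (rule Fubini'[symmetric]) measurable
    also have "\<dots> = (\<integral>\<^sup>+r. emeasure N {x\<in>space N. 0 \<le> r \<and> r < g x} \<partial>lborel)"
    proof (rule nn_integral_cong)
      fix r :: real
      have "(\<integral>\<^sup>+x. indicator E (x, r) \<partial>N)
          = (\<integral>\<^sup>+x. indicator {x\<in>space N. 0 \<le> r \<and> r < g x} x \<partial>N)"
        by (intro nn_integral_cong) (auto simp: E_def space_pair_measure indicator_def)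
      then show "(\<integral>\<^sup>+x. indicator E (x, r) \<partial>N) = emeasure N {x\<in>space N. 0 \<le> r \<and> r < g x}"
        by simp
    qed
    finally show ?thesis .
  qed
  have g' [measurable]: "g \<in> borel_measurable \<nu>" using g sets by (simp cong: measurable_cong_sets)
  have "(\<integral>\<^sup>+x. ennreal (g x) \<partial>\<mu>) = (\<integral>\<^sup>+r. emeasure \<mu> {x\<in>space \<mu>. 0 \<le> r \<and> r < g x} \<partial>lborel)"
    using layer \<mu> by blast
  \<comment> \<open>Superlevel sets are empty outside levels in \<open>[0, c)\<close>, so the excess
    \<open>d\<close> is paid on a length \<open>c\<close> only.\<close>
  also have "\<dots> \<le> (\<integral>\<^sup>+r. emeasure \<nu> {x\<in>space \<nu>. 0 \<le> r \<and> r < g x} + ennreal d * indicator {0..<c} r \<partial>lborel)"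
  proof (rule nn_integral_mono)
    fix r :: real
    let ?S = "{x\<in>space \<mu>. 0 \<le> r \<and> r < g x}"
    have S: "?S \<in> sets \<mu>" using g by measurable
    show "emeasure \<mu> ?S \<le> emeasure \<nu> {x\<in>space \<nu>. 0 \<le> r \<and> r < g x} + ennreal d * indicator {0..<c} r"
    proof (cases "r \<in> {0..<c}")
      case True
      have "emeasure \<mu> ?S \<le> ennreal (measure \<nu> ?S + d)"
        unfolding m.emeasure_eq_measure using le[OF S] by (rule ennreal_leI)
      also have "\<dots> = emeasure \<nu> ?S + ennreal d"
        using \<open>0 \<le> d\<close> by (simp add: n.emeasure_eq_measure)
      finally show ?thesis using True by (simp add: sp)
    next
      case False
      have "?S = {}"
      proof safe
        fix x assume "x \<in> space \<mu>" "0 \<le> r" "r < g x"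
        with bnd[of x] False show "x \<in> {}" by auto
      qed
      then show ?thesis by (simp only: emeasure_empty zero_le)
    qed
  qed
  also have "\<dots> = (\<integral>\<^sup>+x. ennreal (g x) \<partial>\<nu>) + ennreal d * ennreal c"
  proof (subst nn_integral_add)
    interpret pair_sigma_finite lborel \<nu> ..
    have "(\<lambda>r. emeasure \<nu> (Pair r -` {p \<in> space (lborel \<Otimes>\<^sub>M \<nu>). 0 \<le> fst p \<and> fst p < g (snd p)}))
        \<in> borel_measurable lborel"
      by (intro n.measurable_emeasure_Pair) measurable
    moreover have "Pair r -` {p \<in> space (lborel \<Otimes>\<^sub>M \<nu>). 0 \<le> fst p \<and> fst p < g (snd p)}
        = {x\<in>space \<nu>. 0 \<le> r \<and> r < g x}" for r
      by (auto simp: space_pair_measure)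
    ultimately show "(\<lambda>r. emeasure \<nu> {x\<in>space \<nu>. 0 \<le> r \<and> r < g x}) \<in> borel_measurable lborel"
      by simp
    show "(\<integral>\<^sup>+r. emeasure \<nu> {x\<in>space \<nu>. 0 \<le> r \<and> r < g x} \<partial>lborel)
        + (\<integral>\<^sup>+r. ennreal d * indicator {0..<c} r \<partial>lborel)
        = (\<integral>\<^sup>+x. ennreal (g x) \<partial>\<nu>) + ennreal d * ennreal c"
      using layer[OF \<nu> sets[symmetric]] \<open>0 \<le> c\<close> by (simp add: nn_integral_cmult)
  qed simp
  finally have "(\<integral>\<^sup>+x. ennreal (g x) \<partial>\<mu>) \<le> (\<integral>\<^sup>+x. ennreal (g x) \<partial>\<nu>) + ennreal d * ennreal c" .
  moreover have "(\<integral>\<^sup>+x. ennreal (g x) \<partial>\<mu>) = ennreal (\<integral>x. g x \<partial>\<mu>)"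
    using g bnd by (intro nn_integral_eq_integral m.integrable_const_bound[where B = c]) auto
  moreover have "(\<integral>\<^sup>+x. ennreal (g x) \<partial>\<nu>) = ennreal (\<integral>x. g x \<partial>\<nu>)"
    using g' bnd by (intro nn_integral_eq_integral n.integrable_const_bound[where B = c]) (auto simp: sp)
  moreover have "0 \<le> (\<integral>x. g x \<partial>\<nu>)"
    using bnd by (intro integral_nonneg_AE AE_I2) (auto simp: sp)
  ultimately have "ennreal (\<integral>x. g x \<partial>\<mu>) \<le> ennreal ((\<integral>x. g x \<partial>\<nu>) + d * c)"
    using \<open>0 \<le> c\<close> \<open>0 \<le> d\<close> by (simp add: ennreal_mult)
  then show ?thesis
    using \<open>0 \<le> (\<integral>x. g x \<partial>\<nu>)\<close> \<open>0 \<le> c\<close> \<open>0 \<le> d\<close>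
    by (subst (asm) ennreal_le_iff) simp_all
qed

lemma abs_measure_diff_le_tv_dist:
  assumes "prob_space \<mu>" "prob_space \<nu>" "S \<in> sets \<mu>"
  shows "\<bar>measure \<mu> S - measure \<nu> S\<bar> \<le> tv_dist \<mu> \<nu>"
  unfolding tv_dist_def
proof (rule cSUP_upper[OF assms(3)], rule bdd_aboveI2)
  fix B
  interpret m: prob_space \<mu> by fact
  interpret n: prob_space \<nu> by fact
  show "\<bar>measure \<mu> B - measure \<nu> B\<bar> \<le> 1"
    using m.prob_le_1[of B] n.prob_le_1[of B] measure_nonneg[of \<mu> B] measure_nonneg[of \<nu> B] by linarith
qed

lemma tv_dist_le_1:
  assumes "prob_space \<mu>" "prob_space \<nu>"
  shows "tv_dist \<mu> \<nu> \<le> 1"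
  unfolding tv_dist_def
proof (rule cSUP_least)
  fix B
  interpret m: prob_space \<mu> by fact
  interpret n: prob_space \<nu> by fact
  show "\<bar>measure \<mu> B - measure \<nu> B\<bar> \<le> 1"
    using m.prob_le_1[of B] n.prob_le_1[of B] measure_nonneg[of \<mu> B] measure_nonneg[of \<nu> B] by linarith
qed (use sets.empty_sets in blast)

text \<open>Adding \<open>b\<close> moves the values of \<open>f\<close> into
  \<open>[0, 2 b]\<close>; the one-sided bound then applies in both directions, and the shift
  cancels between probability measures.\<close>

lemma abs_integral_diff_le_tv_dist:
  fixes f :: "'a \<Rightarrow> real"
  assumes \<mu>: "prob_space \<mu>" and \<nu>: "prob_space \<nu>" and sets: "sets \<mu> = sets \<nu>"
    and f: "f \<in> borel_measurable \<mu>" and bnd: "\<And>x. x \<in> space \<mu> \<Longrightarrow> \<bar>f x\<bar> \<le> b"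
  shows "\<bar>(\<integral>x. f x \<partial>\<mu>) - (\<integral>x. f x \<partial>\<nu>)\<bar> \<le> 2 * b * tv_dist \<mu> \<nu>"
proof -
  interpret m: prob_space \<mu> by fact
  interpret n: prob_space \<nu> by fact
  have sp: "space \<mu> = space \<nu>" using sets by (rule sets_eq_imp_space_eq)
  have f': "f \<in> borel_measurable \<nu>" using f sets by (simp cong: measurable_cong_sets)
  have int: "integrable \<mu> f" "integrable \<nu> f"
    using f f' bnd by (auto intro!: m.integrable_const_bound[where B = b] n.integrable_const_bound[where B = b] simp: sp)
  note tv = abs_measure_diff_le_tv_dist[OF \<mu> \<nu>]
  have "0 \<le> tv_dist \<mu> \<nu>" using tv[of "{}"] by simp
  have "(\<integral>x. f x + b \<partial>\<mu>) \<le> (\<integral>x. f x + b \<partial>\<nu>) + tv_dist \<mu> \<nu> * (2 * b)"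
  proof (rule integral_le_of_measure_le[OF \<mu> \<nu> sets _ _ _ \<open>0 \<le> tv_dist \<mu> \<nu>\<close>])
    show "0 \<le> f x + b \<and> f x + b \<le> 2 * b" if "x \<in> space \<mu>" for x
      using bnd[OF that] by (auto simp: abs_le_iff)
    show "measure \<mu> S \<le> measure \<nu> S + tv_dist \<mu> \<nu>" if "S \<in> sets \<mu>" for S
      using tv[OF that] by linarith
  qed (use f in simp)
  moreover have "(\<integral>x. f x + b \<partial>\<nu>) \<le> (\<integral>x. f x + b \<partial>\<mu>) + tv_dist \<mu> \<nu> * (2 * b)"
  proof (rule integral_le_of_measure_le[OF \<nu> \<mu> sets[symmetric] _ _ _ \<open>0 \<le> tv_dist \<mu> \<nu>\<close>])
    show "0 \<le> f x + b \<and> f x + b \<le> 2 * b" if "x \<in> space \<nu>" for x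
      using bnd[of x] that by (auto simp: abs_le_iff sp)
    show "measure \<nu> S \<le> measure \<mu> S + tv_dist \<mu> \<nu>" if "S \<in> sets \<nu>" for S
      using tv[of S] that sets by fastforce
  qed (use f' in simp)
  ultimately show ?thesis
    using int by (simp add: m.prob_space n.prob_space abs_le_iff algebra_simps)
qed

text \<open>Iterating the bound \<open>\<bar>P\<^sup>\<tau> f\<bar> \<le> sup \<bar>f\<bar> / 2\<close> for functions of mean zero replaces the
  submultiplicativity of the mixing distance.\<close>

lemma abs_integral_kernel_pow_decay:
  fixes f :: "'z \<Rightarrow> real"
  assumes P: "markov_kernel Z P" and st: "stationary Z P \<rho>" and mix: "mix_dist Z P \<rho> \<tau> \<le> 1/4"
    and "f \<in> borel_measurable Z" "\<And>x. x \<in> space Z \<Longrightarrow> \<bar>f x\<bar> \<le> b" "(\<integral>x. f x \<partial>\<rho>) = 0"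
    and x: "x \<in> space Z"
  shows "\<bar>\<integral>y. f y \<partial>kernel_pow Z P s x\<bar> \<le> b * (1/2) ^ (s div \<tau>)"
proof -
  have \<rho>: "prob_space \<rho>" "sets \<rho> = sets Z" using st by (auto simp: stationary_def)
  note K = kernel_pow_space[OF P]
  \<comment> \<open>The threshold \<open>1/4\<close> enters here:
    \<open>2 * b * (1/4) = b / 2\<close>.\<close>
  have half: "\<bar>\<integral>y. f y \<partial>kernel_pow Z P \<tau> x\<bar> \<le> b / 2"
    if f: "f \<in> borel_measurable Z" "\<And>x. x \<in> space Z \<Longrightarrow> \<bar>f x\<bar> \<le> b" "(\<integral>x. f x \<partial>\<rho>) = 0"
      and x: "x \<in> space Z" for f :: "'z \<Rightarrow> real" and b x
  proof -
    have "tv_dist (kernel_pow Z P \<tau> x) \<rho> \<le> mix_dist Z P \<rho> \<tau>"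
      unfolding mix_dist_def using x K(1) \<rho>(1)
      by (intro cSUP_upper bdd_aboveI2[where M = 1] tv_dist_le_1) auto
    then have "tv_dist (kernel_pow Z P \<tau> x) \<rho> \<le> 1/4" using mix by linarith
    moreover have "0 \<le> b" using f(2)[OF x] by linarith
    ultimately have "2 * b * tv_dist (kernel_pow Z P \<tau> x) \<rho> \<le> 2 * b * (1/4)"
      by (intro mult_left_mono) auto
    moreover have "\<bar>(\<integral>y. f y \<partial>kernel_pow Z P \<tau> x) - (\<integral>y. f y \<partial>\<rho>)\<bar>
        \<le> 2 * b * tv_dist (kernel_pow Z P \<tau> x) \<rho>"
      using f(1,2) K[OF x] \<rho>
      by (intro abs_integral_diff_le_tv_dist) (auto cong: measurable_cong_sets)
    ultimately show ?thesis using f(3) by simp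
  qed
  have "\<bar>\<integral>y. f y \<partial>kernel_pow Z P (r + k * \<tau>) x\<bar> \<le> b * (1/2) ^ k"
    if f: "f \<in> borel_measurable Z" "\<And>x. x \<in> space Z \<Longrightarrow> \<bar>f x\<bar> \<le> b" "(\<integral>x. f x \<partial>\<rho>) = 0"
    for f :: "'z \<Rightarrow> real" and b r k
    using f
  proof (induction k arbitrary: f b)
    case 0
    show ?case using abs_integral_kernel_pow_le[OF P 0(1,2) x] by simp
  next
    case (Suc k)
    \<comment> \<open>The last \<open>\<tau>\<close> steps are absorbed into the test function. By
      stationarity \<open>g\<close> has mean zero again, with half the bound; hence \<open>f\<close>
      and \<open>b\<close> vary in the induction.\<close>
    define g where "g = (\<lambda>x. \<integral>y. f y \<partial>kernel_pow Z P \<tau> x)"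
    have "(\<integral>y. f y \<partial>kernel_pow Z P (r + Suc k * \<tau>) x) = (\<integral>y. g y \<partial>kernel_pow Z P (r + k * \<tau>) x)"
    proof -
      have "r + Suc k * \<tau> = (r + k * \<tau>) + \<tau>" by simp
      then have "kernel_pow Z P (r + Suc k * \<tau>) x = kernel_pow Z P (r + k * \<tau>) x \<bind> kernel_pow Z P \<tau>"
        by (simp only: kernel_pow_add[OF P x])
      then show ?thesis
        unfolding g_def by (simp only: integral_bind_kernel_pow[OF P Suc.prems(1,2) K(1,2)[OF x]])
    qed
    moreover have "(\<integral>x. g x \<partial>\<rho>) = 0"
      using integral_bind_kernel_pow[OF P Suc.prems(1,2) \<rho>, of \<tau>] stationary_kernel_pow[OF P st, of \<tau>]
        Suc.prems(3) by (simp add: g_def)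
    moreover have "g \<in> borel_measurable Z"
      unfolding g_def by (rule borel_measurable_integral_kernel_pow[OF P Suc.prems(1,2)])
    moreover have "\<bar>g y\<bar> \<le> b / 2" if "y \<in> space Z" for y
      unfolding g_def using half[OF Suc.prems that] .
    ultimately show ?case
      using Suc.IH[of g "b / 2"] by simp
  qed
  \<comment> \<open>The remaining \<open>s mod \<tau>\<close> steps are only bounded by the supremum
    of the test function.\<close>
  from this[of f b "s mod \<tau>" "s div \<tau>"] assms show ?thesis
    by (simp add: add.commute)
qed

subsection \<open>Decorrelation along the chain\<close>

lemma measurable_path:
  assumes "\<forall>i\<ge>1. z i \<in> M \<rightarrow>\<^sub>M Z"
  shows "(\<lambda>\<omega>. \<lambda>i\<in>{1..t::nat}. z i \<omega>) \<in> M \<rightarrow>\<^sub>M Pi\<^sub>M {1..t} (\<lambda>_. Z)"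
  using assms by (intro measurable_restrict) auto

lemma sets_history:
  assumes "\<forall>i\<ge>1. z i \<in> M \<rightarrow>\<^sub>M Z"
  shows "sets (history M Z z t) =
    {(\<lambda>\<omega>. \<lambda>i\<in>{1..t}. z i \<omega>) -` A \<inter> space M | A. A \<in> sets (Pi\<^sub>M {1..t} (\<lambda>_. Z))}"
  unfolding history_def
  by (intro sets_vimage_algebra2 funcsetI measurable_space[OF measurable_path[OF assms]])

lemma subalgebra_history:
  assumes "\<forall>i\<ge>1. z i \<in> M \<rightarrow>\<^sub>M Z"
  shows "subalgebra M (history M Z z t)"
  unfolding subalgebra_def
proof
  show "space (history M Z z t) = space M" by (simp add: history_def)
  show "sets (history M Z z t) \<subseteq> sets M"
    unfolding sets_history[OF assms]
    using measurable_sets[OF measurable_path[OF assms]] by blast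
qed

text \<open>An event of the shorter path is the preimage, under the measurable restriction of
  coordinates, of an event of the longer one.\<close>

lemma sets_history_mono:
  assumes z: "\<forall>i\<ge>1. z i \<in> M \<rightarrow>\<^sub>M Z" and "s \<le> t"
  shows "sets (history M Z z s) \<subseteq> sets (history M Z z t)"
proof
  fix S assume "S \<in> sets (history M Z z s)"
  then obtain A where A: "A \<in> sets (Pi\<^sub>M {1..s} (\<lambda>_. Z))" "S = (\<lambda>\<omega>. \<lambda>i\<in>{1..s}. z i \<omega>) -` A \<inter> space M"
    unfolding sets_history[OF z] by blast
  define A' where "A' = (\<lambda>x. restrict x {1..s}) -` A \<inter> space (Pi\<^sub>M {1..t} (\<lambda>_. Z))"
  have "A' \<in> sets (Pi\<^sub>M {1..t} (\<lambda>_. Z))"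
    unfolding A'_def using \<open>s \<le> t\<close> A(1) by (intro measurable_sets[OF measurable_restrict_subset]) auto
  moreover have "restrict (\<lambda>i\<in>{1..t}. z i \<omega>) {1..s} = (\<lambda>i\<in>{1..s}. z i \<omega>)" for \<omega>
    using \<open>s \<le> t\<close> by (auto simp: restrict_def)
  then have "S = (\<lambda>\<omega>. \<lambda>i\<in>{1..t}. z i \<omega>) -` A' \<inter> space M"
    using measurable_space[OF measurable_path[OF z]] by (auto simp: A(2) A'_def)
  ultimately show "S \<in> sets (history M Z z t)"
    unfolding sets_history[OF z] by blast
qed

section \<open>Law of a future state on a past event\<close>

lemma markov_chainD:
  assumes "markov_chain M Z P z"
  shows "prob_space M" "markov_kernel Z P" "\<forall>t\<ge>1. z t \<in> M \<rightarrow>\<^sub>M Z"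
  using assms by (auto simp: markov_chain_def)

text \<open>The Markov property integrated over a past event. The density \<open>indicator S\<close>
  is left unnormalised, so null events need no special treatment.\<close>

lemma markov_chain_step_distr:
  assumes chain: "markov_chain M Z P z" and t: "1 \<le> t" and S: "S \<in> sets (history M Z z t)"
  shows "distr (density M (indicator S)) Z (z (Suc t)) = distr (density M (indicator S)) Z (z t) \<bind> P"
    (is "?L = ?D \<bind> P")
proof -
  interpret prob_space M by (rule markov_chainD(1)[OF chain])
  note z = markov_chainD(3)[OF chain]
  have [measurable]: "z t \<in> M \<rightarrow>\<^sub>M Z" "z (Suc t) \<in> M \<rightarrow>\<^sub>M Z" using z t by auto
  have P [measurable]: "P \<in> Z \<rightarrow>\<^sub>M subprob_algebra Z"
    using markov_chainD(2)[OF chain] by (rule measurable_markov_kernel)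
  have sub: "subalgebra M (history M Z z t)" using z by (rule subalgebra_history)
  have [measurable]: "S \<in> sets M" using S sub unfolding subalgebra_def by blast
  interpret finite_measure_subalgebra M "history M Z z t"
    by unfold_locales (rule sub)
  have sP: "sets (?D \<bind> P) = sets Z"
    using P not_empty measurable_space[OF \<open>z t \<in> M \<rightarrow>\<^sub>M Z\<close>] by (intro sets_bind) (auto simp: sets_kernel[OF P])
  show ?thesis
  proof (rule measure_eqI)
    fix B assume "B \<in> sets ?L"
    then have B [measurable]: "B \<in> sets Z" by simp
    define E where "E = {\<omega> \<in> space M. z (Suc t) \<omega> \<in> B}"
    have [measurable]: "E \<in> sets M" unfolding E_def by measurable
    have "AE \<omega> in M. real_cond_exp M (history M Z z t) (indicator E) \<omega> = measure (P (z t \<omega>)) B"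
      using chain t B unfolding markov_chain_def E_def by blast
    \<comment> \<open>The defining property of conditional expectation, available because
      \<open>S\<close> belongs to the history.\<close>
    moreover have "(\<integral>\<omega>\<in>S. indicator E \<omega> \<partial>M) = (\<integral>\<omega>\<in>S. real_cond_exp M (history M Z z t) (indicator E) \<omega> \<partial>M)"
      using S by (intro real_cond_exp_intA) (auto simp: emeasure_eq_measure)
    moreover have "(\<lambda>\<omega>. measure (P (z t \<omega>)) B) \<in> borel_measurable M"
      by measurable
    ultimately have *: "(\<integral>\<omega>\<in>S. indicator E \<omega> \<partial>M) = (\<integral>\<omega>\<in>S. measure (P (z t \<omega>)) B \<partial>M)"
      unfolding set_lebesgue_integral_def by (auto intro!: integral_cong_AE)
    have prP: "prob_space (P (z t \<omega>))" if "\<omega> \<in> space M" for \<omega>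
    proof -
      have "P (z t \<omega>) \<in> space (prob_algebra Z)"
        using markov_chainD(2)[OF chain] that unfolding markov_kernel_def
        by (intro measurable_space[of P Z] measurable_space[of "z t" M]) auto
      then show ?thesis by (simp add: space_prob_algebra)
    qed
    have "emeasure ?L B = emeasure (density M (indicator S)) E"
      by (subst emeasure_distr) (auto simp: E_def intro!: arg_cong2[where f = emeasure])
    also have "\<dots> = emeasure M (S \<inter> E)"
      by (subst emeasure_density) (auto simp: indicator_inter_arith[symmetric])
    also have "\<dots> = ennreal (\<integral>\<omega>\<in>S. indicator E \<omega> \<partial>M)"
      unfolding set_lebesgue_integral_def
      by (simp add: indicator_inter_arith[symmetric] emeasure_eq_measure)
    also have "\<dots> = ennreal (\<integral>\<omega>. indicator S \<omega> * measure (P (z t \<omega>)) B \<partial>M)"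
      unfolding * by (simp add: set_lebesgue_integral_def)
    also have "\<dots> = (\<integral>\<^sup>+\<omega>. ennreal (indicator S \<omega> * measure (P (z t \<omega>)) B) \<partial>M)"
      using prP prob_space.prob_le_1
      by (intro nn_integral_eq_integral[symmetric] integrable_const_bound[where B = 1] AE_I2)
        (auto simp: indicator_def)
    also have "\<dots> = (\<integral>\<^sup>+\<omega>. indicator S \<omega> * emeasure (P (z t \<omega>)) B \<partial>M)"
      using prP by (intro nn_integral_cong)
        (auto simp: indicator_def prob_space.axioms(1) finite_measure.emeasure_eq_measure)
    also have "\<dots> = (\<integral>\<^sup>+\<omega>. emeasure (P (z t \<omega>)) B \<partial>density M (indicator S))"
      by (subst nn_integral_density) auto
    also have "\<dots> = (\<integral>\<^sup>+x. emeasure (P x) B \<partial>?D)"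
      by (subst nn_integral_distr) auto
    also have "\<dots> = emeasure (?D \<bind> P) B"
      using not_empty measurable_space[OF \<open>z t \<in> M \<rightarrow>\<^sub>M Z\<close>] P B
      by (subst emeasure_bind[where N = Z]) auto
    finally show "emeasure ?L B = emeasure (?D \<bind> P) B" .
  qed (simp add: sP)
qed

text \<open>\<open>S\<close> still belongs to every later history, so the one-step identity iterates
  and associativity of \<open>bind\<close> collects the steps.\<close>

lemma markov_chain_multistep_distr:
  assumes chain: "markov_chain M Z P z" and t: "1 \<le> t" and S: "S \<in> sets (history M Z z t)"
  shows "distr (density M (indicator S)) Z (z (t + s))
    = distr (density M (indicator S)) Z (z t) \<bind> kernel_pow Z P s"
proof (induction s)
  case 0
  have "kernel_pow Z P 0 = return Z" by auto
  then show ?case by (simp only: bind_return'' sets_distr add_0_right)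
next
  case (Suc s)
  let ?D = "distr (density M (indicator S)) Z (z t)"
  note P = markov_chainD(2)[OF chain]
  have "S \<in> sets (history M Z z (t + s))"
    using sets_history_mono[OF markov_chainD(3)[OF chain], of t "t + s"] S by auto
  then have "distr (density M (indicator S)) Z (z (t + Suc s)) = (?D \<bind> kernel_pow Z P s) \<bind> P"
    using markov_chain_step_distr[OF chain, of "t + s" S] t by (simp add: Suc)
  also have "\<dots> = ?D \<bind> (\<lambda>x. kernel_pow Z P s x \<bind> P)"
    using measurable_kernel_pow[OF P, of s] measurable_markov_kernel[OF P]
    by (intro bind_assoc) simp_all
  finally show ?case by simp
qed

text \<open>On \<open>S\<close>, the mean of \<open>f\<close> after \<open>s\<close> more steps is
  that of \<open>P^s f\<close> at the present state. The decay of \<open>P^s f\<close> is uniform in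
  the state, and the restricted law has mass \<open>measure M S\<close>.\<close>

lemma markov_chain_event_decay:
  fixes f :: "'z \<Rightarrow> real"
  assumes chain: "markov_chain M Z P z" and t: "1 \<le> t" and S: "S \<in> sets (history M Z z t)"
    and st: "stationary Z P \<rho>" and mix: "mix_dist Z P \<rho> \<tau> \<le> 1/4"
    and f: "f \<in> borel_measurable Z" "\<And>x. x \<in> space Z \<Longrightarrow> \<bar>f x\<bar> \<le> b" "(\<integral>x. f x \<partial>\<rho>) = 0"
  shows "\<bar>\<integral>\<omega>. indicator S \<omega> * f (z (t + s) \<omega>) \<partial>M\<bar> \<le> b * (1/2) ^ (s div \<tau>) * measure M S"
proof -
  interpret prob_space M by (rule markov_chainD(1)[OF chain])
  note z = markov_chainD(3)[OF chain] and P = markov_chainD(2)[OF chain]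
  have zt: "z t \<in> M \<rightarrow>\<^sub>M Z" "z (t + s) \<in> M \<rightarrow>\<^sub>M Z" using z t by auto
  have SM: "S \<in> sets M"
    using S subalgebra_history[OF z] unfolding subalgebra_def by blast
  define D where "D = density M (indicator S :: _ \<Rightarrow> ennreal)"
  have D_eq: "D = density M (\<lambda>\<omega>. ennreal (indicator S \<omega>))"
    unfolding D_def by (simp add: ennreal_indicator)
  define \<mu> where "\<mu> = distr D Z (z t)"
  have zD: "z t \<in> D \<rightarrow>\<^sub>M Z" "z (t + s) \<in> D \<rightarrow>\<^sub>M Z" using zt by (auto simp: D_def)
  have sp: "space \<mu> = space Z" "sets \<mu> = sets Z" by (auto simp: \<mu>_def)
  have "emeasure \<mu> (space Z) = emeasure D (space M)"
    unfolding \<mu>_def using zD measurable_space[OF zt(1)]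
    by (subst emeasure_distr) (auto simp: D_def intro!: arg_cong2[where f = emeasure])
  also have "\<dots> = emeasure M S"
    unfolding D_def using SM sets.sets_into_space[OF SM]
    by (subst emeasure_density) (auto simp: indicator_inter_arith[symmetric] Int_absorb2)
  finally have mass: "emeasure \<mu> (space Z) = emeasure M S" .
  have fin: "finite_measure \<mu>"
    by (rule finite_measureI) (simp add: sp mass)
  interpret m: finite_measure \<mu> by fact
  define g where "g = (\<lambda>x. \<integral>y. f y \<partial>kernel_pow Z P s x)"
  have g: "\<bar>g x\<bar> \<le> b * (1/2) ^ (s div \<tau>)" if "x \<in> space Z" for x
    unfolding g_def by (rule abs_integral_kernel_pow_decay[OF P st mix f that])
  have "(\<integral>\<omega>. indicator S \<omega> * f (z (t + s) \<omega>) \<partial>M) = (\<integral>\<omega>. f (z (t + s) \<omega>) \<partial>D)"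
    unfolding D_eq using SM measurable_compose[OF zt(2) f(1)]
    by (subst integral_density) auto
  also have "\<dots> = (\<integral>x. f x \<partial>distr D Z (z (t + s)))"
    using zD(2) f(1) by (rule integral_distr[symmetric])
  also have "\<dots> = (\<integral>x. f x \<partial>(\<mu> \<bind> kernel_pow Z P s))"
    unfolding D_def \<mu>_def markov_chain_multistep_distr[OF chain t S] ..
  also have "\<dots> = (\<integral>x. g x \<partial>\<mu>)"
    unfolding g_def
  proof (rule integral_bind[where B = b and B' = 1, OF f(1,2) _ fin])
    show "kernel_pow Z P s \<in> \<mu> \<rightarrow>\<^sub>M subprob_algebra Z"
      using measurable_kernel_pow[OF P, of s] by (simp add: \<mu>_def)
    show "AE x in \<mu>. emeasure (kernel_pow Z P s x) (space (kernel_pow Z P s x)) \<le> ennreal 1"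
      using prob_space.emeasure_space_1[OF kernel_pow_space(1)[OF P]] sp
      by (intro AE_I2) auto
  qed
  finally have "\<bar>\<integral>\<omega>. indicator S \<omega> * f (z (t + s) \<omega>) \<partial>M\<bar> = \<bar>\<integral>x. g x \<partial>\<mu>\<bar>"
    by simp
  also have "\<dots> \<le> (\<integral>x. \<bar>g x\<bar> \<partial>\<mu>)" by (rule integral_abs_bound)
  also have "\<dots> \<le> (\<integral>x. b * (1/2) ^ (s div \<tau>) \<partial>\<mu>)"
  proof (rule integral_mono)
    have "g \<in> borel_measurable \<mu>"
      unfolding g_def using borel_measurable_integral_kernel_pow[OF P f(1,2)] by (simp add: \<mu>_def)
    then show "integrable \<mu> (\<lambda>x. \<bar>g x\<bar>)"
      using g by (intro integrable_abs m.integrable_const_bound[where B = "b * (1/2) ^ (s div \<tau>)"])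
        (auto simp: sp intro!: AE_I2)
  qed (use g in \<open>auto simp: sp\<close>)
  also have "\<dots> = b * (1/2) ^ (s div \<tau>) * measure M S"
    using mass by (simp add: sp measure_def)
  finally show ?thesis .
qed

text \<open>The past enters through simple functions, on whose level sets the previous bound applies;
  truncation at a level above \<open>c\<close> keeps them bounded.\<close>

lemma markov_chain_inner_decay:
  fixes u :: "(nat \<Rightarrow> 'z) \<Rightarrow> 'w::real_inner" and Y :: "'z \<Rightarrow> 'w"
  assumes chain: "markov_chain M Z P z" and t: "1 \<le> t"
    and st: "stationary Z P \<rho>" and mix: "mix_dist Z P \<rho> \<tau> \<le> 1/4"
    and u: "strongly_measurable (Pi\<^sub>M {1..t} (\<lambda>_. Z)) u"
      "\<And>x. x \<in> space (Pi\<^sub>M {1..t} (\<lambda>_. Z)) \<Longrightarrow> norm (u x) \<le> c"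
    and Y: "strongly_measurable Z Y" "\<And>x. x \<in> space Z \<Longrightarrow> norm (Y x) \<le> \<sigma>"
      "\<And>v. (\<integral>x. v \<bullet> Y x \<partial>\<rho>) = 0"
  shows "\<bar>\<integral>\<omega>. u (\<lambda>i\<in>{1..t}. z i \<omega>) \<bullet> Y (z (t + s) \<omega>) \<partial>M\<bar> \<le> c * \<sigma> * (1/2) ^ (s div \<tau>)"
proof -
  interpret prob_space M by (rule markov_chainD(1)[OF chain])
  note z = markov_chainD(3)[OF chain]
  let ?\<Pi> = "Pi\<^sub>M {1..t} (\<lambda>_. Z)" and ?h = "\<lambda>\<omega>. \<lambda>i\<in>{1..t}. z i \<omega>"
  define \<beta> where "\<beta> = (1/2 :: real) ^ (s div \<tau>)"
  have h: "?h \<in> M \<rightarrow>\<^sub>M ?\<Pi>" using z by (rule measurable_path)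
  have zt: "z t \<in> M \<rightarrow>\<^sub>M Z" "z (t + s) \<in> M \<rightarrow>\<^sub>M Z" using z t by auto
  obtain \<omega>\<^sub>0 where \<omega>\<^sub>0: "\<omega>\<^sub>0 \<in> space M" using not_empty by blast
  have "0 \<le> \<sigma>" using Y(2)[OF measurable_space[OF zt(1) \<omega>\<^sub>0]] norm_ge_zero order_trans by blast
  have "0 \<le> c" using u(2)[OF measurable_space[OF h \<omega>\<^sub>0]] norm_ge_zero order_trans by blast
  have Ysm: "strongly_measurable M (\<lambda>\<omega>. Y (z (t + s) \<omega>))"
    using zt(2) Y(1) by (rule strongly_measurable_compose_measurable)
  have Yb: "norm (Y (z (t + s) \<omega>)) \<le> \<sigma>" if "\<omega> \<in> space M" for \<omega>
    using Y(2) measurable_space[OF zt(2) that] .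
  have simple: "\<bar>\<integral>\<omega>. q (?h \<omega>) \<bullet> Y (z (t + s) \<omega>) \<partial>M\<bar> \<le> c' * \<sigma> * \<beta>"
    if q: "simple_function ?\<Pi> q" "\<And>x. norm (q x) \<le> c'" for q c'
  proof -
    have "0 \<le> c'" using q(2) norm_ge_zero order_trans by blast
    define S where "S v = ?h -` (q -` {v} \<inter> space ?\<Pi>) \<inter> space M" for v
    let ?V = "q ` space ?\<Pi>"
    have fin: "finite ?V" and qS: "q -` {v} \<inter> space ?\<Pi> \<in> sets ?\<Pi>" for v
      using q(1) by (auto intro: simple_functionD)
    then have S_hist: "S v \<in> sets (history M Z z t)" for v
      unfolding sets_history[OF z] S_def by blast
    have S_sets: "S v \<in> sets M" for v
      unfolding S_def using h qS by (rule measurable_sets)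
    \<comment> \<open>Used twice: with \<open>F\<close> the inner product against the noise, and
      with \<open>F = 1\<close> to see that the probabilities of the \<open>S v\<close> add up to
      1.\<close>
    have decomp: "(\<Sum>v\<in>?V. indicator (S v) \<omega> * F v) = (F (q (?h \<omega>)) :: real)"
      if "\<omega> \<in> space M" for \<omega> F
    proof -
      have hs: "?h \<omega> \<in> space ?\<Pi>" using measurable_space[OF h that] .
      then have "(\<Sum>v\<in>?V. indicator (S v) \<omega> * F v) = (\<Sum>v\<in>?V. if v = q (?h \<omega>) then F v else 0)"
        using that by (intro sum.cong) (auto simp: S_def indicator_def)
      also have "\<dots> = F (q (?h \<omega>))" using fin hs by simp
      finally show ?thesis .
    qed
    have meas: "(\<lambda>\<omega>. v \<bullet> Y (z (t + s) \<omega>)) \<in> borel_measurable M" for v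
      by (intro borel_measurable_inner_strongly_measurable Ysm
          simple_function_imp_strongly_measurable simple_function_const)
    have CS: "\<bar>v \<bullet> y\<bar> \<le> norm v * \<sigma>" if "norm y \<le> \<sigma>" for v y :: 'w
      using Cauchy_Schwarz_ineq2[of v y] mult_left_mono[OF that, of "norm v"] by simp
    have int: "integrable M (\<lambda>\<omega>. indicator (S v) \<omega> * (v \<bullet> Y (z (t + s) \<omega>)))" for v
    proof (rule integrable_const_bound[where B = "norm v * \<sigma>"])
      show "AE \<omega> in M. norm (indicator (S v) \<omega> * (v \<bullet> Y (z (t + s) \<omega>))) \<le> norm v * \<sigma>"
        using CS Yb \<open>0 \<le> \<sigma>\<close> by (intro AE_I2) (auto simp: indicator_def)
    qed (use S_sets meas in measurable)
    have "(\<integral>\<omega>. q (?h \<omega>) \<bullet> Y (z (t + s) \<omega>) \<partial>M)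
        = (\<integral>\<omega>. (\<Sum>v\<in>?V. indicator (S v) \<omega> * (v \<bullet> Y (z (t + s) \<omega>))) \<partial>M)"
      by (intro Bochner_Integration.integral_cong refl) (rule decomp[symmetric])
    also have "\<dots> = (\<Sum>v\<in>?V. \<integral>\<omega>. indicator (S v) \<omega> * (v \<bullet> Y (z (t + s) \<omega>)) \<partial>M)"
      using int by (rule Bochner_Integration.integral_sum)
    also have "\<bar>\<dots>\<bar> \<le> (\<Sum>v\<in>?V. \<bar>\<integral>\<omega>. indicator (S v) \<omega> * (v \<bullet> Y (z (t + s) \<omega>)) \<partial>M\<bar>)"
      by (rule sum_abs)
    also have "\<dots> \<le> (\<Sum>v\<in>?V. c' * \<sigma> * \<beta> * measure M (S v))"
    proof (rule sum_mono)
      fix v assume "v \<in> ?V"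
      then have v: "norm v \<le> c'" using q(2) by auto
      have "\<bar>\<integral>\<omega>. indicator (S v) \<omega> * (v \<bullet> Y (z (t + s) \<omega>)) \<partial>M\<bar> \<le> norm v * \<sigma> * \<beta> * measure M (S v)"
        unfolding \<beta>_def
        by (rule markov_chain_event_decay[OF chain t S_hist st mix])
          (auto intro!: CS Y borel_measurable_inner_strongly_measurable
            simple_function_imp_strongly_measurable)
      also have "\<dots> \<le> c' * \<sigma> * \<beta> * measure M (S v)"
        using v \<open>0 \<le> \<sigma>\<close> by (intro mult_right_mono) (auto simp: \<beta>_def)
      finally show "\<bar>\<integral>\<omega>. indicator (S v) \<omega> * (v \<bullet> Y (z (t + s) \<omega>)) \<partial>M\<bar> \<le> c' * \<sigma> * \<beta> * measure M (S v)" .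
    qed
    also have "\<dots> = c' * \<sigma> * \<beta> * (\<Sum>v\<in>?V. measure M (S v))"
      by (simp add: sum_distrib_left)
    also have "(\<Sum>v\<in>?V. measure M (S v)) = (\<Sum>v\<in>?V. \<integral>\<omega>. indicator (S v) \<omega> * 1 \<partial>M)"
      using S_sets by simp
    also have "\<dots> = (\<integral>\<omega>. (\<Sum>v\<in>?V. indicator (S v) \<omega> * 1) \<partial>M)"
      using S_sets by (intro Bochner_Integration.integral_sum[symmetric])
        (auto simp: emeasure_eq_measure)
    also have "\<dots> = (\<integral>\<omega>. 1 \<partial>M)"
      by (intro Bochner_Integration.integral_cong refl) (rule decomp)
    also have "\<dots> = 1" by (simp add: prob_space)
    finally show ?thesis by (simp only: mult_1_right)
  qed
  obtain r where r: "\<And>i::nat. simple_function ?\<Pi> (r i)"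
    "\<And>x. x \<in> space ?\<Pi> \<Longrightarrow> (\<lambda>i. r i x) \<longlonglongrightarrow> u x"
    using u(1) unfolding strongly_measurable_def by metis
  have approx: "\<bar>\<integral>\<omega>. u (?h \<omega>) \<bullet> Y (z (t + s) \<omega>) \<partial>M\<bar> \<le> c' * \<sigma> * \<beta>" if "c < c'" for c'
  proof -
    define q where "q i x = (if norm (r i x) \<le> c' then r i x else 0)" for i x
    have q_simple: "simple_function ?\<Pi> (q i)" for i
      using simple_function_compose1[OF r(1), of "\<lambda>y. if norm y \<le> c' then y else 0" i]
      unfolding q_def[abs_def] .
    have q_le: "norm (q i x) \<le> c'" for i x
      using that \<open>0 \<le> c\<close> by (simp add: q_def)
    have q_lim: "(\<lambda>i. q i x) \<longlonglongrightarrow> u x" if x: "x \<in> space ?\<Pi>" for x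
    proof (rule Lim_transform_eventually[OF r(2)[OF x]])
      have "norm (u x) < c'" using u(2)[OF x] \<open>c < c'\<close> by simp
      then have "\<forall>\<^sub>F i in sequentially. norm (r i x) < c'"
        using tendsto_norm[OF r(2)[OF x]] by (rule order_tendstoD(2)[rotated])
      then show "\<forall>\<^sub>F i in sequentially. r i x = q i x"
        by eventually_elim (simp add: q_def)
    qed
    have sm: "strongly_measurable M (\<lambda>\<omega>. v (?h \<omega>))" if "strongly_measurable ?\<Pi> v" for v :: "_ \<Rightarrow> 'w"
      using h that by (rule strongly_measurable_compose_measurable)
    have "(\<lambda>i. \<integral>\<omega>. q i (?h \<omega>) \<bullet> Y (z (t + s) \<omega>) \<partial>M) \<longlonglongrightarrow> (\<integral>\<omega>. u (?h \<omega>) \<bullet> Y (z (t + s) \<omega>) \<partial>M)"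
    proof (rule integral_dominated_convergence[where w = "\<lambda>_. c' * \<sigma>"])
      show "(\<lambda>\<omega>. u (?h \<omega>) \<bullet> Y (z (t + s) \<omega>)) \<in> borel_measurable M"
        by (intro borel_measurable_inner_strongly_measurable sm u(1) Ysm)
      show "(\<lambda>\<omega>. q i (?h \<omega>) \<bullet> Y (z (t + s) \<omega>)) \<in> borel_measurable M" for i
        by (intro borel_measurable_inner_strongly_measurable sm Ysm
            simple_function_imp_strongly_measurable q_simple)
      show "AE \<omega> in M. (\<lambda>i. q i (?h \<omega>) \<bullet> Y (z (t + s) \<omega>)) \<longlonglongrightarrow> u (?h \<omega>) \<bullet> Y (z (t + s) \<omega>)"
        using q_lim measurable_space[OF h] by (intro AE_I2 tendsto_intros) auto
      show "AE \<omega> in M. norm (q i (?h \<omega>) \<bullet> Y (z (t + s) \<omega>)) \<le> c' * \<sigma>" for i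
      proof (rule AE_I2)
        fix \<omega> assume "\<omega> \<in> space M"
        then have "norm (q i (?h \<omega>)) * norm (Y (z (t + s) \<omega>)) \<le> c' * \<sigma>"
          using q_le[of i "?h \<omega>"] Yb by (intro mult_mono) (auto intro: order_trans[OF norm_ge_zero])
        then show "norm (q i (?h \<omega>) \<bullet> Y (z (t + s) \<omega>)) \<le> c' * \<sigma>"
          using Cauchy_Schwarz_ineq2 order_trans by (fastforce simp del: norm_mult)
      qed
    qed simp
    then have "(\<lambda>i. \<bar>\<integral>\<omega>. q i (?h \<omega>) \<bullet> Y (z (t + s) \<omega>) \<partial>M\<bar>) \<longlonglongrightarrow> \<bar>\<integral>\<omega>. u (?h \<omega>) \<bullet> Y (z (t + s) \<omega>) \<partial>M\<bar>"
      by (rule tendsto_rabs)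
    then show ?thesis
      using simple[OF q_simple q_le] by (intro LIMSEQ_le_const2) auto
  qed
  \<comment> \<open>Letting \<open>c'\<close> decrease to \<open>c\<close> removes the slack
    introduced by the truncation.\<close>
  have "((\<lambda>c'. c' * \<sigma> * \<beta>) \<longlongrightarrow> c * \<sigma> * \<beta>) (at_right c)"
    by (intro tendsto_intros)
  moreover have "\<forall>\<^sub>F c' in at_right c.
      \<bar>\<integral>\<omega>. u (?h \<omega>) \<bullet> Y (z (t + s) \<omega>) \<partial>M\<bar> \<le> c' * \<sigma> * \<beta>"
    using eventually_at_right_less[of c] by eventually_elim (rule approx)
  ultimately show ?thesis
    unfolding \<beta>_def[symmetric] by (rule tendsto_lowerbound) simp
qed

subsection \<open>Second moment of the sampling error\<close>

text \<open>The norm weighted by \<open>(n + 1) powr a\<close> never increases, since each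
  contraction factor offsets the growth of the weight. This is the bound on the initial
  error.\<close>

lemma norm_X_prod_le:
  fixes T :: "nat \<Rightarrow> 'w::real_normed_vector \<Rightarrow>\<^sub>L 'w"
  assumes step: "\<And>i v. 1 \<le> i \<Longrightarrow> norm (v - \<gamma> i *\<^sub>R T i v) \<le> (1 - a / real i) * norm v"
    and a: "0 \<le> a" "a \<le> 1"
  shows "norm (X_prod \<gamma> T 1 n v) \<le> (1 / real (Suc n)) powr a * norm v"
proof -
  have "real (Suc n) powr a * norm (X_prod \<gamma> T 1 n v) \<le> norm v"
  proof (induction n)
    case 0
    then show ?case by (simp add: X_prod_empty)
  next
    case (Suc n)
    have "real (Suc (Suc n)) powr a * norm (X_prod \<gamma> T 1 (Suc n) v)
        \<le> real (Suc (Suc n)) powr a * ((1 - a / real (Suc n)) * norm (X_prod \<gamma> T 1 n v))"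
      using step[of "Suc n" "X_prod \<gamma> T 1 n v"] by (intro mult_left_mono) (auto simp: X_prod_Suc)
    also have "\<dots> = ((1 - a / real (Suc n)) * real (Suc (Suc n)) powr a) * norm (X_prod \<gamma> T 1 n v)"
      by (simp only: mult_ac)
    also have "\<dots> \<le> real (Suc n) powr a * norm (X_prod \<gamma> T 1 n v)"
      using a by (intro mult_right_mono one_minus_mult_powr_Suc_le) auto
    finally show ?case using Suc by linarith
  qed
  then show ?thesis
    by (simp add: powr_divide pos_le_divide_eq mult.commute del: of_nat_Suc)
qed

section \<open>Pathwise bounds on the sampling error\<close>

locale markov_sgd =
  fixes M :: "'m measure" and Z :: "'z measure" and P :: "'z \<Rightarrow> 'z measure"
    and z :: "nat \<Rightarrow> 'm \<Rightarrow> 'z" and \<rho> :: "'z measure" and \<tau> :: nat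
    and T :: "'z \<Rightarrow> 'w::real_inner \<Rightarrow>\<^sub>L 'w" and Y :: "'z \<Rightarrow> 'w"
    and \<gamma> :: "nat \<Rightarrow> real" and \<alpha> \<eta> \<sigma> :: real
  assumes chain: "markov_chain M Z P z"
    and st: "stationary Z P \<rho>" and mix: "mix_dist Z P \<rho> \<tau> \<le> 1/4" and tau: "0 < \<tau>"
    and T_sm: "\<And>v. strongly_measurable Z (\<lambda>x. T x v)"
    and T_le: "\<And>x v. x \<in> space Z \<Longrightarrow> norm (T x v) \<le> \<eta> * norm v"
    and T_contr: "\<And>n x v. x \<in> space Z \<Longrightarrow> 1 \<le> n \<Longrightarrow>
      norm (v - \<gamma> n *\<^sub>R T x v) \<le> (1 - \<alpha> / real n) * norm v"
    and Y_sm: "strongly_measurable Z Y" and Y_le: "\<And>x. x \<in> space Z \<Longrightarrow> norm (Y x) \<le> \<sigma>"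
    and Y_mean: "\<And>v. (\<integral>x. v \<bullet> Y x \<partial>\<rho>) = 0"
    and gamma: "\<And>n. 1 \<le> n \<Longrightarrow> \<gamma> n = 1 / (\<eta> * real n)"
    and eta: "0 < \<eta>" and alpha: "0 < \<alpha>" "\<alpha> < 1/2" and sigma: "0 \<le> \<sigma>"
begin

text \<open>A function of a path rather than of an outcome, so that it makes sense both on the
  product space of \<open>path_law\<close> and along the chain.\<close>

definition err :: "nat \<Rightarrow> (nat \<Rightarrow> 'z) \<Rightarrow> 'w" where
  "err n x = samp_sum \<gamma> (\<lambda>k. T (x k)) (\<lambda>i. Y (x i)) n"

lemma err_Suc:
  "err (Suc n) x =
     err n x - \<gamma> (Suc n) *\<^sub>R T (x (Suc n)) (err n x) + \<gamma> (Suc n) *\<^sub>R Y (x (Suc n))"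
  by (simp add: err_def samp_sum_Suc)

lemma err_restrict: "n \<le> m \<Longrightarrow> err n (\<lambda>i\<in>{1..m}. x i) = err n x"
  unfolding err_def by (intro samp_sum_cong) auto

lemma strongly_measurable_err:
  "n \<le> m \<Longrightarrow> strongly_measurable (Pi\<^sub>M {1..m} (\<lambda>_. Z)) (err n)"
proof (induction n)
  case 0
  have "err 0 = (\<lambda>_. 0)" by (auto simp: err_def)
  then show ?case by (simp add: simple_function_imp_strongly_measurable)
next
  case (Suc n)
  have comp: "(\<lambda>x. x (Suc n)) \<in> Pi\<^sub>M {1..m} (\<lambda>_. Z) \<rightarrow>\<^sub>M Z"
    using Suc.prems by (intro measurable_component_singleton) auto
  have "err (Suc n) = (\<lambda>x. err n x - \<gamma> (Suc n) *\<^sub>R T (x (Suc n)) (err n x) + \<gamma> (Suc n) *\<^sub>R Y (x (Suc n)))"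
    by (auto simp: err_Suc)
  moreover have "strongly_measurable (Pi\<^sub>M {1..m} (\<lambda>_. Z)) (err n)"
    using Suc by simp
  moreover from this have "strongly_measurable (Pi\<^sub>M {1..m} (\<lambda>_. Z)) (\<lambda>x. T (x (Suc n)) (err n x))"
    using strongly_measurable_compose_measurable[OF comp T_sm]
    by (rule strongly_measurable_blinfun_apply[rotated])
  moreover have "strongly_measurable (Pi\<^sub>M {1..m} (\<lambda>_. Z)) (\<lambda>x. Y (x (Suc n)))"
    using comp Y_sm by (rule strongly_measurable_compose_measurable)
  ultimately show ?case
    by (simp only:) (intro strongly_measurable_add strongly_measurable_diff strongly_measurable_scaleR)
qed

text \<open>The contraction is used only as nonexpansiveness, and step \<open>i\<close> adds noise
  of norm at most \<open>\<sigma> / (\<eta> * i)\<close>.\<close>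

lemma norm_err_le:
  "(\<And>i. 1 \<le> i \<Longrightarrow> i \<le> n \<Longrightarrow> x i \<in> space Z) \<Longrightarrow> norm (err n x) \<le> \<sigma> / \<eta> * harm n"
proof (induction n)
  case 0
  then show ?case by (simp add: err_def harm_def)
next
  case (Suc n)
  have x: "x (Suc n) \<in> space Z" using Suc.prems by simp
  have "norm (err (Suc n) x)
      \<le> norm (err n x - \<gamma> (Suc n) *\<^sub>R T (x (Suc n)) (err n x)) + norm (\<gamma> (Suc n) *\<^sub>R Y (x (Suc n)))"
    unfolding err_Suc by (rule norm_triangle_ineq)
  also have "norm (err n x - \<gamma> (Suc n) *\<^sub>R T (x (Suc n)) (err n x)) \<le> (1 - \<alpha> / real (Suc n)) * norm (err n x)"
    using T_contr[OF x, of "Suc n"] by simp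
  also have "\<dots> \<le> 1 * norm (err n x)"
    using alpha by (intro mult_right_mono) auto
  also have "norm (\<gamma> (Suc n) *\<^sub>R Y (x (Suc n))) \<le> 1 / (\<eta> * real (Suc n)) * \<sigma>"
  proof -
    have "norm (\<gamma> (Suc n) *\<^sub>R Y (x (Suc n))) = 1 / (\<eta> * real (Suc n)) * norm (Y (x (Suc n)))"
      using eta by (simp only: gamma norm_scaleR le_numeral_extra Suc_le_mono le0 One_nat_def) simp
    also have "\<dots> \<le> 1 / (\<eta> * real (Suc n)) * \<sigma>"
      using Y_le[OF x] eta by (intro mult_left_mono) auto
    finally show ?thesis .
  qed
  finally have "norm (err (Suc n) x) \<le> norm (err n x) + 1 / (\<eta> * real (Suc n)) * \<sigma>"
    by simp
  also have "norm (err n x) \<le> \<sigma> / \<eta> * harm n"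
    using Suc by simp
  finally show ?case
    by (simp add: harm_Suc distrib_left divide_inverse mult_ac del: of_nat_Suc)
qed

text \<open>The increment is \<open>\<gamma> (Y - T e)\<close>: the noise contributes the 1, and the
  drift, at most \<open>\<eta>\<close> times the pathwise bound on \<open>e\<close>, contributes
  \<open>harm n\<close>.\<close>

lemma norm_err_diff_le:
  assumes "\<And>i. 1 \<le> i \<Longrightarrow> i \<le> Suc n \<Longrightarrow> x i \<in> space Z"
  shows "norm (err (Suc n) x - err n x) \<le> \<sigma> / \<eta> * ((1 + harm n) / real (Suc n))"
proof -
  have x: "x (Suc n) \<in> space Z" using assms by simp
  have "norm (T (x (Suc n)) (err n x)) \<le> \<eta> * (\<sigma> / \<eta> * harm n)"
    using T_le[OF x, of "err n x"] norm_err_le[of n x] assms eta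
    by (meson le_Suc_eq mult_left_mono order_trans less_imp_le)
  then have *: "norm (Y (x (Suc n)) - T (x (Suc n)) (err n x)) \<le> \<sigma> + \<sigma> * harm n"
    using Y_le[OF x] eta norm_triangle_ineq4[of "Y (x (Suc n))" "T (x (Suc n)) (err n x)"] by simp
  have "err (Suc n) x - err n x = \<gamma> (Suc n) *\<^sub>R (Y (x (Suc n)) - T (x (Suc n)) (err n x))"
    by (simp add: err_Suc scaleR_diff_right)
  then have "norm (err (Suc n) x - err n x) \<le> 1 / (\<eta> * real (Suc n)) * (\<sigma> + \<sigma> * harm n)"
    using * gamma[of "Suc n"] eta by (simp add: divide_right_mono)
  also have "\<dots> = \<sigma> / \<eta> * ((1 + harm n) / real (Suc n))"
    using eta by (simp add: field_simps del: of_nat_Suc)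
  finally show ?thesis .
qed

text \<open>Only \<open>e \<bullet> Y\<close> is kept exactly, since mixing will control its
  expectation. The other cross term \<open>Te \<bullet> Y\<close> already carries the square of the
  step size and can be bounded pathwise.\<close>

lemma norm_err_Suc_sq_le:
  assumes "\<And>i. 1 \<le> i \<Longrightarrow> i \<le> Suc n \<Longrightarrow> x i \<in> space Z"
  shows "(norm (err (Suc n) x))\<^sup>2 \<le> (1 - \<alpha> / real (Suc n))\<^sup>2 * (norm (err n x))\<^sup>2
    + 2 / (\<eta> * real (Suc n)) * (err n x \<bullet> Y (x (Suc n)))
    + 2 * (\<sigma> / \<eta>)\<^sup>2 / real (Suc n) * ((1 + harm n) / real (Suc n))"
proof -
  have x: "x (Suc n) \<in> space Z" using assms by simp
  define g where "g = 1 / (\<eta> * real (Suc n))"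
  define e y Te where "e = err n x" and "y = Y (x (Suc n))" and "Te = T (x (Suc n)) e"
  have g: "\<gamma> (Suc n) = g" "0 < g" using gamma[of "Suc n"] eta by (auto simp: g_def)
  have y: "norm y \<le> \<sigma>" using Y_le[OF x] by (simp add: y_def)
  have e: "norm e \<le> \<sigma> / \<eta> * harm n" using norm_err_le[of n x] assms by (simp add: e_def)
  have "norm Te \<le> \<eta> * (\<sigma> / \<eta> * harm n)"
    using T_le[OF x, of e] mult_left_mono[OF e, of \<eta>] eta by (simp add: Te_def)
  then have Te: "norm Te \<le> \<sigma> * harm n" using eta by simp
  have "\<bar>Te \<bullet> y\<bar> \<le> norm Te * norm y" by (rule Cauchy_Schwarz_ineq2)
  also have "\<dots> \<le> \<sigma> * harm n * \<sigma>"
    using Te y sigma by (intro mult_mono mult_nonneg_nonneg harm_nonneg) auto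
  finally have Tey: "- (Te \<bullet> y) \<le> \<sigma>\<^sup>2 * harm n" by (simp add: power2_eq_square mult_ac)
  have "norm (e - g *\<^sub>R Te) \<le> (1 - \<alpha> / real (Suc n)) * norm e"
    unfolding Te_def g(1)[symmetric] by (rule T_contr[OF x]) simp
  then have contr: "(norm (e - g *\<^sub>R Te))\<^sup>2 \<le> (1 - \<alpha> / real (Suc n))\<^sup>2 * (norm e)\<^sup>2"
    unfolding power_mult_distrib[symmetric] by (intro power_mono) auto
  have ysq: "(norm y)\<^sup>2 \<le> \<sigma>\<^sup>2" using y by (intro power_mono) auto
  have "(norm (err (Suc n) x))\<^sup>2 = (norm (e - g *\<^sub>R Te + g *\<^sub>R y))\<^sup>2"
    by (simp add: err_Suc e_def y_def Te_def g)
  also have "\<dots> = (norm (e - g *\<^sub>R Te))\<^sup>2 + 2 * g * (e \<bullet> y) + g\<^sup>2 * (2 * (- (Te \<bullet> y)) + (norm y)\<^sup>2)"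
  proof -
    define d where "d = e - g *\<^sub>R Te"
    have 1: "(d + g *\<^sub>R y) \<bullet> (d + g *\<^sub>R y) = d \<bullet> d + 2 * g * (d \<bullet> y) + g\<^sup>2 * (y \<bullet> y)"
      by (simp add: inner_add_left inner_add_right inner_commute[of y d] power2_eq_square
          distrib_left)
    have 2: "d \<bullet> y = e \<bullet> y - g * (Te \<bullet> y)"
      by (simp add: d_def inner_diff_left)
    show ?thesis
      unfolding power2_norm_eq_inner d_def[symmetric] 1 2 by (simp add: power2_eq_square algebra_simps)
  qed
  also have "\<dots> \<le> (1 - \<alpha> / real (Suc n))\<^sup>2 * (norm e)\<^sup>2 + 2 * g * (e \<bullet> y)
      + g\<^sup>2 * (2 * (\<sigma>\<^sup>2 * harm n) + 2 * \<sigma>\<^sup>2)"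
  proof -
    \<comment> \<open>The noise square is doubled so that the bound factors through
      \<open>1 + harm n\<close>, the shape of the increment bounds.\<close>
    have "2 * (- (Te \<bullet> y)) + (norm y)\<^sup>2 \<le> 2 * (\<sigma>\<^sup>2 * harm n) + 2 * \<sigma>\<^sup>2"
      using Tey ysq zero_le_power2[of \<sigma>] by linarith
    from mult_left_mono[OF this zero_le_power2[of g]] contr show ?thesis by linarith
  qed
  also have "g\<^sup>2 * (2 * (\<sigma>\<^sup>2 * harm n) + 2 * \<sigma>\<^sup>2)
      = 2 * (\<sigma> / \<eta>)\<^sup>2 / real (Suc n) * ((1 + harm n) / real (Suc n))"
  proof -
    have "(1 / (\<eta> * m))\<^sup>2 * (2 * (\<sigma>\<^sup>2 * h) + 2 * \<sigma>\<^sup>2) = 2 * (\<sigma> / \<eta>)\<^sup>2 / m * ((1 + h) / m)" for m h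
      by (simp add: divide_inverse power2_eq_square algebra_simps)
    then show ?thesis unfolding g_def .
  qed
  finally show ?thesis
    by (simp add: g_def e_def y_def)
qed

section \<open>Expectations along the chain and the tail bound\<close>

sublocale prob_space M
  by (rule markov_chainD(1)[OF chain])

lemma z_in_space: "\<omega> \<in> space M \<Longrightarrow> 1 \<le> i \<Longrightarrow> z i \<omega> \<in> space Z"
  by (rule measurable_space[of "z i" M]) (use markov_chainD(3)[OF chain] in auto)

lemma strongly_measurable_err_chain: "strongly_measurable M (\<lambda>\<omega>. err n (\<lambda>k. z k \<omega>))"
proof -
  have "strongly_measurable M (\<lambda>\<omega>. err n (\<lambda>i\<in>{1..n}. z i \<omega>))"
    by (rule strongly_measurable_compose_measurable[OF measurable_path[OF markov_chainD(3)[OF chain]]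
          strongly_measurable_err]) simp
  then show ?thesis by (simp only: err_restrict order_refl)
qed

lemma strongly_measurable_Y_chain: "1 \<le> n \<Longrightarrow> strongly_measurable M (\<lambda>\<omega>. Y (z n \<omega>))"
  by (rule strongly_measurable_compose_measurable[OF _ Y_sm]) (use markov_chainD(3)[OF chain] in auto)

lemma integrable_norm_err_sq: "integrable M (\<lambda>\<omega>. (norm (err n (\<lambda>k. z k \<omega>)))\<^sup>2)"
proof (rule integrable_const_bound[where B = "(\<sigma> / \<eta> * harm n)\<^sup>2"])
  show "AE \<omega> in M. norm ((norm (err n (\<lambda>k. z k \<omega>)))\<^sup>2) \<le> (\<sigma> / \<eta> * harm n)\<^sup>2"
    using norm_err_le z_in_space by (intro AE_I2) (auto intro!: power_mono)
  show "(\<lambda>\<omega>. (norm (err n (\<lambda>k. z k \<omega>)))\<^sup>2) \<in> borel_measurable M"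
    unfolding power2_norm_eq_inner
    by (intro borel_measurable_inner_strongly_measurable strongly_measurable_err_chain)
qed

lemma integrable_inner_Y:
  assumes "strongly_measurable M u" "1 \<le> n" "\<And>\<omega>. \<omega> \<in> space M \<Longrightarrow> norm (u \<omega>) \<le> c"
  shows "integrable M (\<lambda>\<omega>. u \<omega> \<bullet> Y (z n \<omega>))"
proof (rule integrable_const_bound[where B = "c * \<sigma>"])
  show "AE \<omega> in M. norm (u \<omega> \<bullet> Y (z n \<omega>)) \<le> c * \<sigma>"
  proof (rule AE_I2)
    fix \<omega> assume \<omega>: "\<omega> \<in> space M"
    have "norm (u \<omega> \<bullet> Y (z n \<omega>)) \<le> norm (u \<omega>) * norm (Y (z n \<omega>))"
      by (simp add: Cauchy_Schwarz_ineq2)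
    also have "\<dots> \<le> c * \<sigma>"
      using assms(3)[OF \<omega>] Y_le[OF z_in_space[OF \<omega> assms(2)]]
      by (intro mult_mono) (auto intro: order_trans[OF norm_ge_zero])
    finally show "norm (u \<omega> \<bullet> Y (z n \<omega>)) \<le> c * \<sigma>" .
  qed
  show "(\<lambda>\<omega>. u \<omega> \<bullet> Y (z n \<omega>)) \<in> borel_measurable M"
    using assms by (intro borel_measurable_inner_strongly_measurable strongly_measurable_Y_chain)
qed

text \<open>Telescoping \<open>err n\<close> into its increments decorrelates each of them from the present
  noise at its own time lag.\<close>

lemma expectation_err_inner_Y_le:
  "(\<integral>\<omega>. err n (\<lambda>k. z k \<omega>) \<bullet> Y (z (Suc n) \<omega>) \<partial>M)
     \<le> (\<Sum>j<n. \<sigma> / \<eta> * ((1 + harm j) / real (Suc j)) * \<sigma> * (1/2) ^ ((n - j) div \<tau>))"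
proof -
  define D where "D j x = err (Suc j) x - err j x" for j x
  \<comment> \<open>No boundary term appears because \<open>err 0\<close> vanishes.\<close>
  have tele: "err n x = (\<Sum>j<n. D j x)" for x
    using sum_lessThan_telescope[of "\<lambda>j. err j x" n] by (simp add: D_def) (simp add: err_def)
  have D_sm: "strongly_measurable (Pi\<^sub>M {1..Suc j} (\<lambda>_. Z)) (D j)" for j
    unfolding D_def by (intro strongly_measurable_diff strongly_measurable_err) auto
  have D_restrict: "D j (\<lambda>i\<in>{1..Suc j}. x i) = D j x" for j x
    unfolding D_def by (simp only: err_restrict order_refl le_Suc_eq simp_thms)
  have D_chain: "strongly_measurable M (\<lambda>\<omega>. D j (\<lambda>k. z k \<omega>))" for j
    unfolding D_def by (intro strongly_measurable_diff strongly_measurable_err_chain)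
  have "(\<integral>\<omega>. err n (\<lambda>k. z k \<omega>) \<bullet> Y (z (Suc n) \<omega>) \<partial>M)
      = (\<integral>\<omega>. (\<Sum>j<n. D j (\<lambda>k. z k \<omega>) \<bullet> Y (z (Suc n) \<omega>)) \<partial>M)"
    by (simp only: tele inner_sum_left)
  also have "\<dots> = (\<Sum>j<n. \<integral>\<omega>. D j (\<lambda>k. z k \<omega>) \<bullet> Y (z (Suc n) \<omega>) \<partial>M)"
  proof (rule Bochner_Integration.integral_sum)
    show "integrable M (\<lambda>\<omega>. D j (\<lambda>k. z k \<omega>) \<bullet> Y (z (Suc n) \<omega>))" for j
    proof (rule integrable_inner_Y[OF D_chain])
      show "norm (D j (\<lambda>k. z k \<omega>)) \<le> \<sigma> / \<eta> * ((1 + harm j) / real (Suc j))" if "\<omega> \<in> space M" for \<omega>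
        unfolding D_def by (intro norm_err_diff_le z_in_space that)
    qed simp
  qed
  also have "\<dots> \<le> (\<Sum>j<n. \<sigma> / \<eta> * ((1 + harm j) / real (Suc j)) * \<sigma> * (1/2) ^ ((n - j) div \<tau>))"
  proof (rule sum_mono)
    fix j assume "j \<in> {..<n}"
    \<comment> \<open>\<open>D j\<close> depends on the states up to time \<open>Suc j\<close> and
      the noise sits at time \<open>Suc n\<close>, so the lag is \<open>n - j\<close>.\<close>
    then have n: "Suc n = Suc j + (n - j)" by simp
    have "\<bar>\<integral>\<omega>. D j (\<lambda>i\<in>{1..Suc j}. z i \<omega>) \<bullet> Y (z (Suc j + (n - j)) \<omega>) \<partial>M\<bar>
        \<le> \<sigma> / \<eta> * ((1 + harm j) / real (Suc j)) * \<sigma> * (1/2) ^ ((n - j) div \<tau>)"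
    proof (rule markov_chain_inner_decay[OF chain _ st mix D_sm _ Y_sm Y_le Y_mean])
      show "norm (D j x) \<le> \<sigma> / \<eta> * ((1 + harm j) / real (Suc j))"
        if "x \<in> space (Pi\<^sub>M {1..Suc j} (\<lambda>_. Z))" for x
        unfolding D_def using that by (intro norm_err_diff_le) (auto simp: space_PiM PiE_iff)
    qed simp
    then show "(\<integral>\<omega>. D j (\<lambda>k. z k \<omega>) \<bullet> Y (z (Suc n) \<omega>) \<partial>M)
        \<le> \<sigma> / \<eta> * ((1 + harm j) / real (Suc j)) * \<sigma> * (1/2) ^ ((n - j) div \<tau>)"
      unfolding D_restrict n[symmetric] by linarith
  qed
  finally show ?thesis .
qed

lemma second_moment_err_le:
  "(\<integral>\<omega>. (norm (err n (\<lambda>k. z k \<omega>)))\<^sup>2 \<partial>M)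
     \<le> (\<sigma> / \<eta>)\<^sup>2 * (28 * real \<tau> / (1 - 2 * \<alpha>)) / real (Suc n) powr \<alpha>"
proof (rule second_moment_recursion_bound[OF alpha _ tau])
  fix n
  define g where "g j = (1 + harm j) / real (Suc j)" for j
  define b where "b k = (1/2::real) ^ (k div \<tau>)" for k
  let ?e = "\<lambda>n \<omega>. err n (\<lambda>k. z k \<omega>)"
  define I where "I = (\<integral>\<omega>. ?e n \<omega> \<bullet> Y (z (Suc n) \<omega>) \<partial>M)"
  have int: "integrable M (\<lambda>\<omega>. ?e n \<omega> \<bullet> Y (z (Suc n) \<omega>))"
    by (rule integrable_inner_Y[OF strongly_measurable_err_chain _ norm_err_le]) (auto intro: z_in_space)
  have "(\<integral>\<omega>. (norm (?e (Suc n) \<omega>))\<^sup>2 \<partial>M)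
      \<le> (\<integral>\<omega>. (1 - \<alpha> / real (Suc n))\<^sup>2 * (norm (?e n \<omega>))\<^sup>2
          + 2 / (\<eta> * real (Suc n)) * (?e n \<omega> \<bullet> Y (z (Suc n) \<omega>))
          + 2 * (\<sigma> / \<eta>)\<^sup>2 / real (Suc n) * g n \<partial>M)"
    unfolding g_def
  proof (rule integral_mono)
    fix \<omega> assume "\<omega> \<in> space M"
    then show "(norm (?e (Suc n) \<omega>))\<^sup>2 \<le> (1 - \<alpha> / real (Suc n))\<^sup>2 * (norm (?e n \<omega>))\<^sup>2
          + 2 / (\<eta> * real (Suc n)) * (?e n \<omega> \<bullet> Y (z (Suc n) \<omega>))
          + 2 * (\<sigma> / \<eta>)\<^sup>2 / real (Suc n) * ((1 + harm n) / real (Suc n))"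
      using norm_err_Suc_sq_le[of n "\<lambda>k. z k \<omega>"] z_in_space by simp
  qed (use int integrable_norm_err_sq in auto)
  also have "\<dots> = (1 - \<alpha> / real (Suc n))\<^sup>2 * (\<integral>\<omega>. (norm (?e n \<omega>))\<^sup>2 \<partial>M)
      + 2 / (\<eta> * real (Suc n)) * I + 2 * (\<sigma> / \<eta>)\<^sup>2 / real (Suc n) * g n"
    using int integrable_norm_err_sq by (simp add: I_def prob_space)
  also have "2 / (\<eta> * real (Suc n)) * I
      \<le> 2 / (\<eta> * real (Suc n)) * (\<Sum>j<n. \<sigma> / \<eta> * g j * \<sigma> * b (n - j))"
    unfolding I_def g_def b_def using eta by (intro mult_left_mono expectation_err_inner_Y_le) auto
  also have "\<dots> = 2 * (\<sigma> / \<eta>)\<^sup>2 / real (Suc n) * (\<Sum>j<n. b (n - j) * g j)"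
    unfolding sum_distrib_left by (intro sum.cong) (auto simp: power2_eq_square mult_ac)
  finally have "(\<integral>\<omega>. (norm (?e (Suc n) \<omega>))\<^sup>2 \<partial>M)
      \<le> (1 - \<alpha> / real (Suc n))\<^sup>2 * (\<integral>\<omega>. (norm (?e n \<omega>))\<^sup>2 \<partial>M)
        + 2 * (\<sigma> / \<eta>)\<^sup>2 / real (Suc n) * ((\<Sum>j<n. b (n - j) * g j) + b 0 * g n)"
    by (simp add: b_def distrib_left)
  \<comment> \<open>The pathwise term supplies the summand \<open>j = n\<close> that the cross term
    leaves out, as \<open>b 0 = 1\<close>.\<close>
  also have "(\<Sum>j<n. b (n - j) * g j) + b 0 * g n = (\<Sum>j\<le>n. b (n - j) * g j)"
    by (simp add: lessThan_Suc_atMost[symmetric])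
  finally show "(\<integral>\<omega>. (norm (?e (Suc n) \<omega>))\<^sup>2 \<partial>M)
      \<le> (1 - \<alpha> / real (Suc n))\<^sup>2 * (\<integral>\<omega>. (norm (?e n \<omega>))\<^sup>2 \<partial>M)
        + 2 * (\<sigma> / \<eta>)\<^sup>2 / real (Suc n)
          * (\<Sum>j\<le>n. (1/2) ^ ((n - j) div \<tau>) * ((1 + harm j) / real (Suc j)))"
    by (simp only: b_def g_def)
qed (auto simp: err_def)

text \<open>Markov's inequality for the squared norm. The radius is chosen so that
  \<open>\<delta>\<close> times its square equals the second moment bound, with
  \<open>28 = 2^2 * 7\<close>; the event is then transported to the law of the path.\<close>

lemma prob_err_le:
  assumes \<delta>: "0 < \<delta>" "\<delta> < 1"
  shows "\<P>(x in path_law M Z z n. norm (err n x)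
      \<le> 2 * \<sigma> / \<eta> * sqrt (7 / (\<delta> * (1 - 2 * \<alpha>))) * sqrt (real \<tau> / real (Suc n) powr \<alpha>)) \<ge> 1 - \<delta>"
proof -
  define R where "R = 2 * \<sigma> / \<eta> * sqrt (7 / (\<delta> * (1 - 2 * \<alpha>))) * sqrt (real \<tau> / real (Suc n) powr \<alpha>)"
  let ?e = "\<lambda>\<omega>. err n (\<lambda>k. z k \<omega>)" and ?\<Pi> = "Pi\<^sub>M {1..n} (\<lambda>_. Z)"
  note path = measurable_path[OF markov_chainD(3)[OF chain], of n]
  have [measurable]: "(\<lambda>x. norm (err n x)) \<in> borel_measurable ?\<Pi>"
    by (intro measurable_compose[OF strongly_measurable_imp_borel_measurable borel_measurable_norm]
        strongly_measurable_err order_refl)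
  have e_meas [measurable]: "(\<lambda>\<omega>. norm (?e \<omega>)) \<in> borel_measurable M"
    by (intro measurable_compose[OF strongly_measurable_imp_borel_measurable borel_measurable_norm]
        strongly_measurable_err_chain)
  have "\<P>(x in path_law M Z z n. norm (err n x) \<le> R)
      = measure M ((\<lambda>\<omega>. \<lambda>i\<in>{1..n}. z i \<omega>) -` {x\<in>space ?\<Pi>. norm (err n x) \<le> R} \<inter> space M)"
  proof -
    have "{x\<in>space ?\<Pi>. norm (err n x) \<le> R} \<in> sets ?\<Pi>" by measurable
    from measure_distr[OF path this] show ?thesis
      by (simp only: path_law_def space_distr)
  qed
  also have "(\<lambda>\<omega>. \<lambda>i\<in>{1..n}. z i \<omega>) -` {x\<in>space ?\<Pi>. norm (err n x) \<le> R} \<inter> space M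
      = {\<omega>\<in>space M. norm (?e \<omega>) \<le> R}"
    using measurable_space[OF path] by (auto simp: err_restrict simp del: One_nat_def)
  finally have law: "\<P>(x in path_law M Z z n. norm (err n x) \<le> R) = \<P>(\<omega> in M. norm (?e \<omega>) \<le> R)" .
  have "1 - \<delta> \<le> \<P>(\<omega> in M. norm (?e \<omega>) \<le> R)"
  proof (cases "\<sigma> = 0")
    \<comment> \<open>Here the radius is 0 and Markov's inequality would divide by zero, but the
      error vanishes on every path.\<close>
    case True
    have "norm (?e \<omega>) \<le> R" if "\<omega> \<in> space M" for \<omega>
      using norm_err_le[of n "\<lambda>k. z k \<omega>", OF z_in_space[OF that]] True by (simp add: R_def)
    then have "{\<omega>\<in>space M. norm (?e \<omega>) \<le> R} = space M"
      by auto
    then show ?thesis using \<delta> prob_space by simp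
  next
    case False
    have R2: "\<delta> * R\<^sup>2 = (\<sigma> / \<eta>)\<^sup>2 * (28 * real \<tau> / (1 - 2 * \<alpha>)) / real (Suc n) powr \<alpha>"
    proof -
      have "R\<^sup>2 = (2 * \<sigma> / \<eta>)\<^sup>2 * (7 / (\<delta> * (1 - 2 * \<alpha>))) * (real \<tau> / real (Suc n) powr \<alpha>)"
        using \<delta> alpha by (simp only: R_def power_mult_distrib) (simp del: of_nat_Suc)
      also have "\<delta> * \<dots> = (\<sigma> / \<eta>)\<^sup>2 * (28 * real \<tau> / (1 - 2 * \<alpha>)) / real (Suc n) powr \<alpha>"
        using \<delta> by (simp add: power2_eq_square mult_ac del: of_nat_Suc)
      finally show ?thesis .
    qed
    have "R > 0"
    proof -
      have "0 < 2 * \<sigma> / \<eta>" "0 < 7 / (\<delta> * (1 - 2 * \<alpha>))" "0 < real \<tau> / real (Suc n) powr \<alpha>"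
        using False sigma eta \<delta> alpha tau by (auto intro!: divide_pos_pos mult_pos_pos)
      then show ?thesis
        unfolding R_def by (intro mult_pos_pos real_sqrt_gt_zero)
    qed
    then have Rsq: "0 < R\<^sup>2" by simp
    have "\<P>(\<omega> in M. R\<^sup>2 \<le> (norm (?e \<omega>))\<^sup>2) \<le> (\<integral>\<omega>. (norm (?e \<omega>))\<^sup>2 \<partial>M) / R\<^sup>2"
      by (rule integral_Markov_inequality_measure[OF integrable_norm_err_sq sets.top _ Rsq]) simp
    also have "\<dots> \<le> (\<delta> * R\<^sup>2) / R\<^sup>2"
      unfolding R2 by (intro divide_right_mono second_moment_err_le) auto
    finally have tail: "\<P>(\<omega> in M. R\<^sup>2 \<le> (norm (?e \<omega>))\<^sup>2) \<le> \<delta>"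
      using \<open>R > 0\<close> by simp
    have "1 = \<P>(\<omega> in M. True)" by (simp add: prob_space)
    also have "\<dots> \<le> measure M ({\<omega>\<in>space M. norm (?e \<omega>) \<le> R} \<union> {\<omega>\<in>space M. R\<^sup>2 \<le> (norm (?e \<omega>))\<^sup>2})"
      using \<open>R > 0\<close> by (intro finite_measure_mono) (auto intro!: power_mono)
    also have "\<dots> \<le> \<P>(\<omega> in M. norm (?e \<omega>) \<le> R) + \<P>(\<omega> in M. R\<^sup>2 \<le> (norm (?e \<omega>))\<^sup>2)"
      by (intro measure_Un_le) measurable
    finally show ?thesis using tail by linarith
  qed
  then show ?thesis
    unfolding law[unfolded R_def] unfolding R_def .
qed

end

section \<open>From quadratic potentials to the abstract chain\<close>

theorem proposition4p4:
  fixes A :: "'w::{real_inner, banach} \<Rightarrow>\<^sub>L 'w" and B :: 'w and C :: real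
    and V :: "'w \<Rightarrow> real" and wstar w1 :: 'w
    and Vz :: "'z \<Rightarrow> 'w \<Rightarrow> real" and Az :: "'z \<Rightarrow> 'w \<Rightarrow>\<^sub>L 'w" and Bz :: "'z \<Rightarrow> 'w"
    and Z :: "'z measure" and P :: "'z \<Rightarrow> 'z measure" and \<rho> :: "'z measure"
    and M :: "'m measure" and z :: "nat \<Rightarrow> 'm \<Rightarrow> 'z" and w :: "nat \<Rightarrow> 'm \<Rightarrow> 'w"
    and \<gamma> :: "nat \<Rightarrow> real" and \<sigma> \<kappa> \<eta> \<alpha> :: real and tmix :: nat
  assumes V: "V = quadratic A B C" "pos_def_op A" "bounded_inverse_op A"
    and wstar: "\<And>v. v \<noteq> wstar \<Longrightarrow> V wstar < V v"
    and Az_sym: "\<And>x. x \<in> space Z \<Longrightarrow> symmetric_op (Az x)"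
    and Vz_grad: "\<And>x v. x \<in> space Z \<Longrightarrow> GDERIV (Vz x) v :> blinfun_apply (Az x) v + Bz x"
    and Vz_int: "\<And>v. bochner_integrable \<rho> (\<lambda>x. grad (Vz x) v)"
    and Vz_mean: "has_bochner_int \<rho> (\<lambda>x. grad (Vz x) wstar) 0"
    and sigma: "\<sigma> \<ge> 0" "\<And>x. x \<in> space Z \<Longrightarrow> (norm (grad (Vz x) wstar))\<^sup>2 \<le> \<sigma>\<^sup>2"
    and convex: "0 < \<kappa>" "\<kappa> \<le> \<eta>"
      "\<And>x. x \<in> space Z \<Longrightarrow> smooth_strongly_convex \<kappa> \<eta> (Vz x)"
    and alpha: "\<alpha> = \<kappa> / \<eta>" "0 < \<alpha>" "\<alpha> < 1/2"
    and chain: "markov_chain M Z P z"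
    and rho: "stationary Z P \<rho>" "\<And>\<rho>'. stationary Z P \<rho>' \<Longrightarrow> \<rho>' = \<rho>"
    and tmix: "\<exists>t\<ge>1. mix_dist Z P \<rho> t \<le> 1/4" "tmix = mixing_time Z P \<rho> (1/4)"
    and gamma: "\<And>t. t \<ge> 1 \<Longrightarrow> \<gamma> t = 1 / (\<eta> * real t)"
    and sgd: "\<And>\<omega>. \<omega> \<in> space M \<Longrightarrow> w 1 \<omega> = w1"
      "\<And>t \<omega>. t \<ge> 1 \<Longrightarrow> \<omega> \<in> space M \<Longrightarrow>
         w (t + 1) \<omega> = w t \<omega> - \<gamma> t *\<^sub>R grad (Vz (z t \<omega>)) (w t \<omega>)"
  shows "\<forall>t\<ge>1.
    (\<forall>\<omega>\<in>space M.
       norm (w t \<omega> - wstar)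
         \<le> err_init \<gamma> (\<lambda>k. Az (z k \<omega>)) w1 wstar t
           + err_samp \<gamma> (\<lambda>k. Az (z k \<omega>)) (\<lambda>i. grad (Vz (z i \<omega>)) wstar) t
       \<and> err_init \<gamma> (\<lambda>k. Az (z k \<omega>)) w1 wstar t \<le> (1 / real t) powr \<alpha> * norm (w1 - wstar))
    \<and> (\<forall>\<delta>. 0 < \<delta> \<and> \<delta> < 1 \<longrightarrow>
         \<P>(x in path_law M Z z (t - 1).
              err_samp \<gamma> (\<lambda>k. Az (x k)) (\<lambda>i. grad (Vz (x i)) wstar) t
                \<le> 2 * \<sigma> / \<eta> * sqrt (7 / (\<delta> * (1 - 2 * \<alpha>))) * sqrt (real tmix / real t powr \<alpha>))
         \<ge> 1 - \<delta>)"
proof -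
  have markov: "prob_space M" "markov_kernel Z P" "\<forall>t\<ge>1. z t \<in> M \<rightarrow>\<^sub>M Z"
    using markov_chainD[OF chain] by auto
  have eta: "0 < \<eta>" using convex(1,2) by linarith
  have \<rho>: "sets \<rho> = sets Z" "space \<rho> = space Z"
    using rho(1) sets_eq_imp_space_eq[of \<rho> Z] by (auto simp: stationary_def)
  have z: "z i \<omega> \<in> space Z" if "\<omega> \<in> space M" "1 \<le> i" for i \<omega>
    using markov(3) that by (intro measurable_space[of "z i" M]) auto
  have grad: "grad (Vz x) v = Az x v + Bz x" if "x \<in> space Z" for x v
    using Vz_grad[OF that] by (rule grad_eq)
  define Y where "Y x = grad (Vz x) wstar" for x
  have grad_wstar: "grad (Vz x) v = Az x (v - wstar) + Y x" if "x \<in> space Z" for x v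
    by (simp add: Y_def grad[OF that] blinfun.diff_right)
  have ell: "\<kappa> * (v \<bullet> v) \<le> Az x v \<bullet> v" "Az x v \<bullet> v \<le> \<eta> * (v \<bullet> v)" if "x \<in> space Z" for x v
    using smooth_strongly_convex_affine_gradient[OF convex(3)[OF that] Vz_grad[OF that]] by auto
  \<comment> \<open>Measurability in the sample comes from Bochner integrability under
    \<open>\<rho>\<close>; it holds everywhere and depends only on the sets, which
    \<open>\<rho>\<close> shares with \<open>Z\<close>.\<close>
  have sm: "strongly_measurable Z (\<lambda>x. grad (Vz x) v)" for v
    using Vz_int[of v] unfolding bochner_integrable_def has_bochner_int_def
    by (auto simp: strongly_measurable_cong_sets[OF \<rho>(1)])
  \<comment> \<open>The difference of the gradients at \<open>v\<close> and at \<open>0\<close>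
    cancels \<open>Bz\<close>.\<close>
  have Az_sm: "strongly_measurable Z (\<lambda>x. Az x v)" for v
    using strongly_measurable_diff[OF sm[of v] sm[of 0]]
    by (rule strongly_measurable_cong[THEN iffD1, rotated 2]) (auto simp: grad)
  have contr: "norm (v - \<gamma> n *\<^sub>R Az x v) \<le> (1 - \<alpha> / real n) * norm v"
    if "x \<in> space Z" "1 \<le> n" for n x v
  proof -
    have "\<gamma> n * \<eta> = 1 / real n" "\<gamma> n * \<kappa> = \<alpha> / real n" "0 \<le> \<gamma> n"
      using gamma[OF that(2)] eta alpha(1) by auto
    moreover have "1 / real n \<le> 1" "\<alpha> / real n < 1"
      using that(2) alpha by (auto simp: divide_simps)
    ultimately show ?thesis
      using norm_gradient_step_le[OF Az_sym[OF that(1)] ell[OF that(1)], of "\<gamma> n" v] by simp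
  qed
  have tmix_props: "1 \<le> tmix \<and> mix_dist Z P \<rho> tmix \<le> 1/4"
    unfolding tmix(2) mixing_time_def by (rule LeastI_ex) (use tmix(1) in blast)
  interpret markov_sgd M Z P z \<rho> tmix Az Y \<gamma> \<alpha> \<eta> \<sigma>
  proof
    show "norm (Az x v) \<le> \<eta> * norm v" if "x \<in> space Z" for x v
      by (rule norm_symmetric_op_le[OF Az_sym[OF that] ell[OF that] convex(1) eta])
    show "norm (Y x) \<le> \<sigma>" if "x \<in> space Z" for x
      using sigma(2)[OF that] sigma(1) unfolding Y_def by (rule power2_le_imp_le)
    show "(\<integral>x. v \<bullet> Y x \<partial>\<rho>) = 0" for v
      using has_bochner_integral_inner_right[OF Vz_mean, of v]
      by (simp add: Y_def has_bochner_integral_integral_eq)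
    show "strongly_measurable Z Y"
      using sm[of wstar] by (simp add: Y_def[abs_def])
  qed (use chain rho(1) tmix_props Az_sm contr gamma eta alpha sigma(1) in auto)
  \<comment> \<open>The sign is negative because the iteration subtracts the gradient noise that
    \<open>err\<close> adds; the triangle inequality ignores it.\<close>
  have decomp: "w (Suc n) \<omega> - wstar = X_prod \<gamma> (\<lambda>k. Az (z k \<omega>)) 1 n (w1 - wstar) - err n (\<lambda>k. z k \<omega>)"
    if \<omega>: "\<omega> \<in> space M" for n \<omega>
  proof (induction n)
    case 0
    then show ?case using sgd(1)[OF \<omega>] by (simp add: X_prod_empty err_def)
  next
    case (Suc n)
    have "w (Suc (Suc n)) \<omega> - wstar
        = (w (Suc n) \<omega> - wstar) - \<gamma> (Suc n) *\<^sub>R (Az (z (Suc n) \<omega>) (w (Suc n) \<omega> - wstar) + Y (z (Suc n) \<omega>))"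
      using sgd(2)[of "Suc n" \<omega>] \<omega> grad_wstar[OF z[OF \<omega>]] by simp
    then show ?case
      unfolding Suc by (simp add: X_prod_Suc err_Suc blinfun.diff_right blinfun.add_right algebra_simps)
  qed
  show ?thesis
  proof (intro allI impI conjI ballI)
    fix t :: nat and \<omega> assume "1 \<le> t" and \<omega>: "\<omega> \<in> space M"
    then obtain n where t: "t = Suc n" by (cases t) auto
    show "norm (w t \<omega> - wstar)
        \<le> err_init \<gamma> (\<lambda>k. Az (z k \<omega>)) w1 wstar t
          + err_samp \<gamma> (\<lambda>k. Az (z k \<omega>)) (\<lambda>i. grad (Vz (z i \<omega>)) wstar) t"
      unfolding t decomp[OF \<omega>]
      using norm_triangle_ineq4 by (simp add: err_init_def err_samp_eq_norm_samp_sum err_def Y_def)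
    show "err_init \<gamma> (\<lambda>k. Az (z k \<omega>)) w1 wstar t \<le> (1 / real t) powr \<alpha> * norm (w1 - wstar)"
      unfolding t err_init_def diff_Suc_1
      by (rule norm_X_prod_le) (use contr z \<omega> alpha in auto)
  next
    fix t :: nat and \<delta> :: real assume "1 \<le> t" and \<delta>: "0 < \<delta> \<and> \<delta> < 1"
    then obtain n where t: "t = Suc n" by (cases t) auto
    show "1 - \<delta> \<le> \<P>(x in path_law M Z z (t - 1).
        err_samp \<gamma> (\<lambda>k. Az (x k)) (\<lambda>i. grad (Vz (x i)) wstar) t
          \<le> 2 * \<sigma> / \<eta> * sqrt (7 / (\<delta> * (1 - 2 * \<alpha>))) * sqrt (real tmix / real t powr \<alpha>))"
      using prob_err_le[of \<delta> n] \<delta>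
      by (simp only: t diff_Suc_1 err_samp_eq_norm_samp_sum err_def Y_def)
  qed
qed

end
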